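(* Let $n\ge2$ and $m\ge2$ be integers and let $\mathfrak{G}$ be a generalized $n$-matrix ring, with diagonal rings $\mathfrak{R}_1,\dots,\mathfrak{R}_n$, such that for all $1\le i\neq j\le n$: (i) for $a_{ii}\in\mathfrak{R}_i$, if $a_{ii}\mathfrak{R}_i=0$ then $a_{ii}=0$; (ii) for $b_{jj}\in\mathfrak{R}_j$, if $\mathfrak{R}_jb_{jj}=0$ then $b_{jj}=0$. Then any $m$-multiplicative derivation $d$ of $\mathfrak{G}$ is additive, i.e. $d(x+y)=d(x)+d(y)$ for all $x,y\in\mathfrak{G}$.
   Context: Rings are associative, not necessarily with identity. A map $d:\mathfrak{S}\to\mathfrak{S}$ of a ring $\mathfrak{S}$ (not assumed additive) is an $m$-multiplicative derivation if $d(x_1\cdots x_m)=\sum_{i=1}^m x_1\cdots x_{i-1}\,d(x_i)\,x_{i+1}\cdots x_m$ for all $x_1,\dots,x_m\in\mathfrak{S}$. Generalized $n$-matrix ring: let $\mathfrak{R}_1,\dots,\mathfrak{R}_n$ be rings and, for $i,j\in\{1,\dots,n\}$, let $\mathfrak{M}_{ij}$ be an $(\mathfrak{R}_i,\mathfrak{R}_j)$-bimodule, with $\mathfrak{M}_{ii}=\mathfrak{R}_i$. Let $\varphi_{ijk}:\mathfrak{M}_{ij}\otimes_{\mathfrak{R}_j}\mathfrak{M}_{jk}\to\mathfrak{M}_{ik}$ be $(\mathfrak{R}_i,\mathfrak{R}_k)$-bimodule homomorphisms, where $\varphi_{iij}:\mathfrak{R}_i\otimes_{\mathfrak{R}_i}\mathfrak{M}_{ij}\to\mathfrak{M}_{ij}$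 and $\varphi_{ijj}:\mathfrak{M}_{ij}\otimes_{\mathfrak{R}_j}\mathfrak{R}_j\to\mathfrak{M}_{ij}$ are the canonical isomorphisms (given by the module actions). Write $a\circ b=\varphi_{ijk}(a\otimes b)$ for $a\in\mathfrak{M}_{ij}$, $b\in\mathfrak{M}_{jk}$. It is assumed that for all $i\neq j$: (1) $\mathfrak{M}_{ij}$ is faithful as a left $\mathfrak{R}_i$-module and faithful as a right $\mathfrak{R}_j$-module; (2) if $m_{ij}\in\mathfrak{M}_{ij}$ satisfies $\mathfrak{R}_i m_{ij}\mathfrak{R}_j=0$, then $m_{ij}=0$. Let $\mathfrak{G}$ be the set of all $n\times n$ matrices $[m_{ij}]$ with $(i,j)$-entry $m_{ij}\in\mathfrak{M}_{ij}$, with the obvious matrix addition and multiplication (using $\circ$). When $a\circ(b\circ c)=(a\circ b)\circ c$ for all $a\in\mathfrak{M}_{ik}$, $b\in\mathfrak{M}_{kl}$, $c\in\mathfrak{M}_{lj}$ and all indices, $\mathfrak{G}$ is a ring, called a generalized $n$-matrix ring. *)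

theory Defs
  imports "HOL-Algebra.Algebra"
begin

section \<open>Rings without identity and their bimodules\<close>

text \<open>
  The record type of HOL-Algebra rings is reused for rings that need not have an identity;
  the field \<^const>\<open>one\<close> then carries no meaning.
\<close>

locale nonunital_ring = abelian_group R for R (structure) +
  assumes m_closed: "\<lbrakk>x \<in> carrier R; y \<in> carrier R\<rbrakk> \<Longrightarrow> x \<otimes> y \<in> carrier R"
    and m_assoc: "\<lbrakk>x \<in> carrier R; y \<in> carrier R; z \<in> carrier R\<rbrakk>
      \<Longrightarrow> (x \<otimes> y) \<otimes> z = x \<otimes> (y \<otimes> z)"
    and l_distr: "\<lbrakk>x \<in> carrier R; y \<in> carrier R; z \<in> carrier R\<rbrakk>
      \<Longrightarrow> (x \<oplus> y) \<otimes> z = x \<otimes> z \<oplus> y \<otimes> z"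
    and r_distr: "\<lbrakk>x \<in> carrier R; y \<in> carrier R; z \<in> carrier R\<rbrakk>
      \<Longrightarrow> z \<otimes> (x \<oplus> y) = z \<otimes> x \<oplus> z \<otimes> y"

text \<open>
  As for \<^typ>\<open>('a, 'b) module\<close> in HOL-Algebra, a bimodule record extends a ring record in order to
  inherit the additive structure; its fields \<^const>\<open>monoid.mult\<close> and \<^const>\<open>one\<close> carry no meaning.
\<close>

record ('r, 's, 'm) bimodule = "'m ring" +
  lsmult :: "'r \<Rightarrow> 'm \<Rightarrow> 'm"
  rsmult :: "'m \<Rightarrow> 's \<Rightarrow> 'm"

locale bimodule = R: nonunital_ring R + S: nonunital_ring S + M: abelian_group M
  for R :: "('r, 'x) ring_scheme" and S :: "('s, 'y) ring_scheme"
    and M :: "('r, 's, 'm, 'z) bimodule_scheme" +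
  assumes lsmult_closed: "\<lbrakk>r \<in> carrier R; x \<in> carrier M\<rbrakk> \<Longrightarrow> lsmult M r x \<in> carrier M"
    and lsmult_add_left: "\<lbrakk>r \<in> carrier R; r' \<in> carrier R; x \<in> carrier M\<rbrakk>
      \<Longrightarrow> lsmult M (r \<oplus>\<^bsub>R\<^esub> r') x = lsmult M r x \<oplus>\<^bsub>M\<^esub> lsmult M r' x"
    and lsmult_add_right: "\<lbrakk>r \<in> carrier R; x \<in> carrier M; y \<in> carrier M\<rbrakk>
      \<Longrightarrow> lsmult M r (x \<oplus>\<^bsub>M\<^esub> y) = lsmult M r x \<oplus>\<^bsub>M\<^esub> lsmult M r y"
    and lsmult_assoc: "\<lbrakk>r \<in> carrier R; r' \<in> carrier R; x \<in> carrier M\<rbrakk>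
      \<Longrightarrow> lsmult M (r \<otimes>\<^bsub>R\<^esub> r') x = lsmult M r (lsmult M r' x)"
    and rsmult_closed: "\<lbrakk>x \<in> carrier M; s \<in> carrier S\<rbrakk> \<Longrightarrow> rsmult M x s \<in> carrier M"
    and rsmult_add_left: "\<lbrakk>x \<in> carrier M; y \<in> carrier M; s \<in> carrier S\<rbrakk>
      \<Longrightarrow> rsmult M (x \<oplus>\<^bsub>M\<^esub> y) s = rsmult M x s \<oplus>\<^bsub>M\<^esub> rsmult M y s"
    and rsmult_add_right: "\<lbrakk>x \<in> carrier M; s \<in> carrier S; s' \<in> carrier S\<rbrakk>
      \<Longrightarrow> rsmult M x (s \<oplus>\<^bsub>S\<^esub> s') = rsmult M x s \<oplus>\<^bsub>M\<^esub> rsmult M x s'"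
    and rsmult_assoc: "\<lbrakk>x \<in> carrier M; s \<in> carrier S; s' \<in> carrier S\<rbrakk>
      \<Longrightarrow> rsmult M x (s \<otimes>\<^bsub>S\<^esub> s') = rsmult M (rsmult M x s) s'"
    and smult_assoc: "\<lbrakk>r \<in> carrier R; x \<in> carrier M; s \<in> carrier S\<rbrakk>
      \<Longrightarrow> rsmult M (lsmult M r x) s = lsmult M r (rsmult M x s)"

definition regular_bimodule :: "('a, 'x) ring_scheme \<Rightarrow> ('a, 'a, 'a) bimodule" where
  "regular_bimodule R = \<lparr>carrier = carrier R, monoid.mult = monoid.mult R, one = \<one>\<^bsub>R\<^esub>, ring.zero = \<zero>\<^bsub>R\<^esub>,
     ring.add = ring.add R, lsmult = monoid.mult R, rsmult = monoid.mult R\<rparr>"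

definition faithful_left_module ::
    "('r, 'x) ring_scheme \<Rightarrow> ('r, 's, 'm, 'z) bimodule_scheme \<Rightarrow> bool" where
  "faithful_left_module R M \<longleftrightarrow>
     (\<forall>r \<in> carrier R. (\<forall>x \<in> carrier M. lsmult M r x = \<zero>\<^bsub>M\<^esub>) \<longrightarrow> r = \<zero>\<^bsub>R\<^esub>)"

definition faithful_right_module ::
    "('s, 'y) ring_scheme \<Rightarrow> ('r, 's, 'm, 'z) bimodule_scheme \<Rightarrow> bool" where
  "faithful_right_module S M \<longleftrightarrow>
     (\<forall>s \<in> carrier S. (\<forall>x \<in> carrier M. rsmult M x s = \<zero>\<^bsub>M\<^esub>) \<longrightarrow> s = \<zero>\<^bsub>S\<^esub>)"

definition bimodule_hom ::
    "('r, 'x) ring_scheme \<Rightarrow> ('s, 'y) ring_scheme \<Rightarrow> ('r, 's, 'm, 'z) bimodule_scheme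
      \<Rightarrow> ('r, 's, 'k, 'w) bimodule_scheme \<Rightarrow> ('m \<Rightarrow> 'k) set" where
  "bimodule_hom R S M N = {f \<in> carrier M \<rightarrow> carrier N.
     (\<forall>x \<in> carrier M. \<forall>y \<in> carrier M. f (x \<oplus>\<^bsub>M\<^esub> y) = f x \<oplus>\<^bsub>N\<^esub> f y) \<and>
     (\<forall>r \<in> carrier R. \<forall>x \<in> carrier M. f (lsmult M r x) = lsmult N r (f x)) \<and>
     (\<forall>x \<in> carrier M. \<forall>s \<in> carrier S. f (rsmult M x s) = rsmult N (f x) s)}"

definition bimodule_iso ::
    "('r, 'x) ring_scheme \<Rightarrow> ('s, 'y) ring_scheme \<Rightarrow> ('r, 's, 'm, 'z) bimodule_scheme
      \<Rightarrow> ('r, 's, 'k, 'w) bimodule_scheme \<Rightarrow> ('m \<Rightarrow> 'k) set" where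
  "bimodule_iso R S M N = {f \<in> bimodule_hom R S M N. bij_betw f (carrier M) (carrier N)}"


section \<open>Tensor products of bimodules\<close>

text \<open>
  The tensor product of \<open>M\<close> and \<open>N\<close> over \<open>S\<close> is the free abelian group on
  \<open>carrier M \<times> carrier N\<close> modulo the subgroup generated by the biadditivity and balancing relations.
\<close>

definition tensor_relators ::
    "('s, 'y) ring_scheme \<Rightarrow> ('r, 's, 'm, 'z) bimodule_scheme \<Rightarrow> ('s, 't, 'k, 'w) bimodule_scheme
      \<Rightarrow> ('m \<times> 'k \<Rightarrow>\<^sub>0 int) set" where
  "tensor_relators S M N =
     {frag_of (x \<oplus>\<^bsub>M\<^esub> x', y) - frag_of (x, y) - frag_of (x', y) | x x' y.
        x \<in> carrier M \<and> x' \<in> carrier M \<and> y \<in> carrier N} \<union>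
     {frag_of (x, y \<oplus>\<^bsub>N\<^esub> y') - frag_of (x, y) - frag_of (x, y') | x y y'.
        x \<in> carrier M \<and> y \<in> carrier N \<and> y' \<in> carrier N} \<union>
     {frag_of (rsmult M x s, y) - frag_of (x, lsmult N s y) | x s y.
        x \<in> carrier M \<and> s \<in> carrier S \<and> y \<in> carrier N}"

abbreviation tensor_free ::
    "('r, 's, 'm, 'z) bimodule_scheme \<Rightarrow> ('s, 't, 'k, 'w) bimodule_scheme
      \<Rightarrow> ('m \<times> 'k \<Rightarrow>\<^sub>0 int) monoid" where
  "tensor_free M N \<equiv> free_Abelian_group (carrier M \<times> carrier N)"

definition tensor_kernel ::
    "('s, 'y) ring_scheme \<Rightarrow> ('r, 's, 'm, 'z) bimodule_scheme \<Rightarrow> ('s, 't, 'k, 'w) bimodule_scheme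
      \<Rightarrow> ('m \<times> 'k \<Rightarrow>\<^sub>0 int) set" where
  "tensor_kernel S M N = generate (tensor_free M N) (tensor_relators S M N)"

definition tensor ::
    "('s, 'y) ring_scheme \<Rightarrow> ('r, 's, 'm, 'z) bimodule_scheme \<Rightarrow> ('s, 't, 'k, 'w) bimodule_scheme
      \<Rightarrow> 'm \<Rightarrow> 'k \<Rightarrow> ('m \<times> 'k \<Rightarrow>\<^sub>0 int) set" where
  "tensor S M N x y = tensor_kernel S M N #>\<^bsub>tensor_free M N\<^esub> frag_of (x, y)"

text \<open>
  The outer actions are the linear extensions of \<open>r (x \<otimes> y) = (r x) \<otimes> y\<close> and
  \<open>(x \<otimes> y) t = x \<otimes> (y t)\<close>. The image of a coset of the kernel under such an extension is only a
  subset of a coset; adding the kernel yields that coset.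
\<close>

definition tensor_product ::
    "('s, 'y) ring_scheme \<Rightarrow> ('r, 's, 'm, 'z) bimodule_scheme \<Rightarrow> ('s, 't, 'k, 'w) bimodule_scheme
      \<Rightarrow> ('r, 't, ('m \<times> 'k \<Rightarrow>\<^sub>0 int) set) bimodule" where
  "tensor_product S M N =
     (let F = tensor_free M N; K = tensor_kernel S M N in
      \<lparr>carrier = carrier (F Mod K), monoid.mult = undefined, one = undefined,
       ring.zero = \<one>\<^bsub>F Mod K\<^esub>, ring.add = monoid.mult (F Mod K),
       lsmult = (\<lambda>r C. K <#>\<^bsub>F\<^esub> frag_extend (\<lambda>(x, y). frag_of (lsmult M r x, y)) ` C),
       rsmult = (\<lambda>C t. K <#>\<^bsub>F\<^esub> frag_extend (\<lambda>(x, y). frag_of (x, rsmult N y t)) ` C)\<rparr>)"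


section \<open>Generalized matrix rings\<close>

text \<open>
  The bimodules \<open>M i j\<close> are sets in a common type \<open>'a\<close> with operations of their own. This is no
  restriction, since a finite family of bimodules embeds into the disjoint union of its members.
\<close>

locale generalized_matrix_ring =
  fixes n :: nat
    and R :: "nat \<Rightarrow> 'a ring"
    and M :: "nat \<Rightarrow> nat \<Rightarrow> ('a, 'a, 'a) bimodule"
    and \<phi> :: "nat \<Rightarrow> nat \<Rightarrow> nat \<Rightarrow> ('a \<times> 'a \<Rightarrow>\<^sub>0 int) set \<Rightarrow> 'a"
  assumes ring: "i \<in> {1..n} \<Longrightarrow> nonunital_ring (R i)"
    and bimodule: "\<lbrakk>i \<in> {1..n}; j \<in> {1..n}\<rbrakk> \<Longrightarrow> bimodule (R i) (R j) (M i j)"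
    and diagonal: "i \<in> {1..n} \<Longrightarrow> M i i = regular_bimodule (R i)"
    and phi_hom: "\<lbrakk>i \<in> {1..n}; j \<in> {1..n}; k \<in> {1..n}\<rbrakk> \<Longrightarrow>
      \<phi> i j k \<in> bimodule_hom (R i) (R k) (tensor_product (R j) (M i j) (M j k)) (M i k)"
    and phi_left_iso: "\<lbrakk>i \<in> {1..n}; j \<in> {1..n}\<rbrakk> \<Longrightarrow>
      \<phi> i i j \<in> bimodule_iso (R i) (R j) (tensor_product (R i) (M i i) (M i j)) (M i j)"
    and phi_left: "\<lbrakk>i \<in> {1..n}; j \<in> {1..n}; r \<in> carrier (R i); x \<in> carrier (M i j)\<rbrakk> \<Longrightarrow>
      \<phi> i i j (tensor (R i) (M i i) (M i j) r x) = lsmult (M i j) r x"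
    and phi_right_iso: "\<lbrakk>i \<in> {1..n}; j \<in> {1..n}\<rbrakk> \<Longrightarrow>
      \<phi> i j j \<in> bimodule_iso (R i) (R j) (tensor_product (R j) (M i j) (M j j)) (M i j)"
    and phi_right: "\<lbrakk>i \<in> {1..n}; j \<in> {1..n}; x \<in> carrier (M i j); s \<in> carrier (R j)\<rbrakk> \<Longrightarrow>
      \<phi> i j j (tensor (R j) (M i j) (M j j) x s) = rsmult (M i j) x s"
    and faithful_left: "\<lbrakk>i \<in> {1..n}; j \<in> {1..n}; i \<noteq> j\<rbrakk> \<Longrightarrow> faithful_left_module (R i) (M i j)"
    and faithful_right: "\<lbrakk>i \<in> {1..n}; j \<in> {1..n}; i \<noteq> j\<rbrakk> \<Longrightarrow> faithful_right_module (R j) (M i j)"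
    and two_sided_faithful: "\<lbrakk>i \<in> {1..n}; j \<in> {1..n}; i \<noteq> j; x \<in> carrier (M i j);
        \<forall>r \<in> carrier (R i). \<forall>s \<in> carrier (R j). rsmult (M i j) (lsmult (M i j) r x) s = \<zero>\<^bsub>M i j\<^esub>\<rbrakk>
      \<Longrightarrow> x = \<zero>\<^bsub>M i j\<^esub>"
    and phi_assoc: "\<lbrakk>i \<in> {1..n}; k \<in> {1..n}; l \<in> {1..n}; j \<in> {1..n};
        a \<in> carrier (M i k); b \<in> carrier (M k l); c \<in> carrier (M l j)\<rbrakk> \<Longrightarrow>
      \<phi> i k j (tensor (R k) (M i k) (M k j) a (\<phi> k l j (tensor (R l) (M k l) (M l j) b c))) =
      \<phi> i l j (tensor (R l) (M i l) (M l j) (\<phi> i k l (tensor (R k) (M i k) (M k l) a b)) c)"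
begin

definition circ :: "nat \<Rightarrow> nat \<Rightarrow> nat \<Rightarrow> 'a \<Rightarrow> 'a \<Rightarrow> 'a" where
  "circ i j k a b = \<phi> i j k (tensor (R j) (M i j) (M j k) a b)"

definition matrices :: "(nat \<times> nat \<Rightarrow> 'a) ring" where
  "matrices =
     \<lparr>carrier = (\<Pi>\<^sub>E (i, j) \<in> {1..n} \<times> {1..n}. carrier (M i j)),
      monoid.mult = (\<lambda>A B. \<lambda>(i, k) \<in> {1..n} \<times> {1..n}.
        \<Oplus>\<^bsub>M i k\<^esub>j \<in> {1..n}. circ i j k (A (i, j)) (B (j, k))),
      one = undefined,
      ring.zero = (\<lambda>(i, j) \<in> {1..n} \<times> {1..n}. \<zero>\<^bsub>M i j\<^esub>),
      ring.add = (\<lambda>A B. \<lambda>(i, j) \<in> {1..n} \<times> {1..n}. A (i, j) \<oplus>\<^bsub>M i j\<^esub> B (i, j))\<rparr>"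

end


section \<open>Multiplicative derivations\<close>

text \<open>Only meaningful for nonempty lists, since there need not be an identity.\<close>

definition list_prod :: "('a, 'x) ring_scheme \<Rightarrow> 'a list \<Rightarrow> 'a" where
  "list_prod S xs = foldl (monoid.mult S) (hd xs) (tl xs)"

definition multiplicative_derivation ::
    "nat \<Rightarrow> ('a, 'x) ring_scheme \<Rightarrow> ('a \<Rightarrow> 'a) \<Rightarrow> bool" where
  "multiplicative_derivation m S d \<longleftrightarrow>
     d \<in> carrier S \<rightarrow> carrier S \<and>
     (\<forall>xs. length xs = m \<longrightarrow> set xs \<subseteq> carrier S \<longrightarrow>
        d (list_prod S xs) = (\<Oplus>\<^bsub>S\<^esub>i \<in> {..<m}. list_prod S (xs[i := d (xs ! i)])))"

end

theory Submission
  imports Defs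
begin

text \<open>
  Write \<open>P\<^sub>i\<^sub>j\<close> for the matrices supported at \<open>(i, j)\<close>, and let \<open>A\<close>, \<open>B\<close> be products of \<open>m - 1\<close> elements of
  \<open>P\<^sub>k\<^sub>k\<close> and of \<open>P\<^sub>l\<^sub>l\<close>. The derivation rule makes \<open>d (A z B) - A d(z) B\<close> additive in \<open>z\<close>, so the defect
  \<open>\<Delta>(x, y) = d (x + y) - d x - d y\<close> satisfies \<open>A \<Delta>(x, y) B = \<Delta>(A x B, A y B)\<close>; by the faithfulness
  conditions \<open>\<Delta>(x, y) = 0\<close> as soon as all these products vanish. Since \<open>A x B\<close> and \<open>A y B\<close> lie in
  \<open>P\<^sub>k\<^sub>l\<close>, it suffices to treat \<open>x, y \<in> P\<^sub>k\<^sub>l\<close>, and no decomposition of a matrix into its entries is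
  needed. Arguments in different rows or columns have no defect because one of the products is zero.
  For \<open>k \<noteq> l\<close> this additivity allows expanding \<open>d ((a + y) (x + b) c\<^sub>3 \<dots> c\<^sub>m)\<close> with \<open>a \<in> P\<^sub>k\<^sub>k\<close>,
  \<open>b, c\<^sub>i \<in> P\<^sub>l\<^sub>l\<close>, where \<open>ab = 0 = yx\<close>; this gives \<open>\<Delta>(a x C, y b C) = 0\<close> for \<open>C = c\<^sub>3 \<dots> c\<^sub>m\<close>. The case \<open>k = l\<close>
  is reduced to the previous one by multiplying by an element of \<open>P\<^sub>k\<^sub>j\<close>, \<open>j \<noteq> k\<close>, and using that
  this bimodule is faithful.
\<close>

section \<open>Additive maps and finite sums\<close>

text \<open>The image of zero equals its own double. The map is an arbitrary additive function
  between abelian groups, so this also covers multiplication by a fixed ring element and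
  \<open>circ\<close> with one argument fixed.\<close>

lemma additive_zero:
  assumes "abelian_group A" "abelian_group B" "f \<in> carrier A \<rightarrow> carrier B"
    and "\<And>x y. \<lbrakk>x \<in> carrier A; y \<in> carrier A\<rbrakk> \<Longrightarrow> f (x \<oplus>\<^bsub>A\<^esub> y) = f x \<oplus>\<^bsub>B\<^esub> f y"
  shows "f \<zero>\<^bsub>A\<^esub> = \<zero>\<^bsub>B\<^esub>"
proof -
  interpret A: abelian_group A by fact
  interpret B: abelian_group B by fact
  have c: "f \<zero>\<^bsub>A\<^esub> \<in> carrier B" using assms(3) by auto
  have "f \<zero>\<^bsub>A\<^esub> \<oplus>\<^bsub>B\<^esub> f \<zero>\<^bsub>A\<^esub> = f \<zero>\<^bsub>A\<^esub>"
    using assms(4)[of "\<zero>\<^bsub>A\<^esub>" "\<zero>\<^bsub>A\<^esub>"] by simp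
  then show ?thesis using c by (simp add: B.add.l_cancel_one)
qed

text \<open>Serves to move a fixed factor past a finite sum, in \<open>leibniz_Cons\<close> and in
  the associativity of matrix multiplication.\<close>

lemma additive_finsum:
  assumes "abelian_group A" "abelian_group B" "f \<in> carrier A \<rightarrow> carrier B"
    and "\<And>x y. \<lbrakk>x \<in> carrier A; y \<in> carrier A\<rbrakk> \<Longrightarrow> f (x \<oplus>\<^bsub>A\<^esub> y) = f x \<oplus>\<^bsub>B\<^esub> f y"
    and "finite S" "g \<in> S \<rightarrow> carrier A"
  shows "f (\<Oplus>\<^bsub>A\<^esub>s \<in> S. g s) = (\<Oplus>\<^bsub>B\<^esub>s \<in> S. f (g s))"
  using assms(5,6)
proof (induction S rule: finite_induct)
  case empty
  interpret A: abelian_group A by fact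
  interpret B: abelian_group B by fact
  show ?case using additive_zero[OF assms(1-4)] by simp
next
  case (insert s S)
  interpret A: abelian_group A by fact
  interpret B: abelian_group B by fact
  have g: "g s \<in> carrier A" "g \<in> S \<rightarrow> carrier A" using insert.prems by auto
  moreover have fg: "(\<lambda>s. f (g s)) \<in> S \<rightarrow> carrier B" "f (g s) \<in> carrier B"
    using g assms(3) by auto
  ultimately show ?case
    using insert assms(4)[OF g(1) A.finsum_closed[OF g(2)]]
    by (simp add: A.finsum_insert B.finsum_insert)
qed

lemma (in abelian_group) finsum_swap:
  assumes "finite A" "finite B" "\<And>i j. \<lbrakk>i \<in> A; j \<in> B\<rbrakk> \<Longrightarrow> f i j \<in> carrier G"
  shows "(\<Oplus>i \<in> A. \<Oplus>j \<in> B. f i j) = (\<Oplus>j \<in> B. \<Oplus>i \<in> A. f i j)"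
  using assms(1,3)
proof (induction A rule: finite_induct)
  case empty
  then show ?case by (simp add: finsum_zero)
next
  case (insert a A)
  then have "(\<lambda>j. f a j) \<in> B \<rightarrow> carrier G" "(\<lambda>i. \<Oplus>j \<in> B. f i j) \<in> A \<rightarrow> carrier G"
      "(\<lambda>j. \<Oplus>i \<in> A. f i j) \<in> B \<rightarrow> carrier G"
    by (auto intro!: finsum_closed)
  moreover have "(\<Oplus>j \<in> B. \<Oplus>i \<in> insert a A. f i j) = (\<Oplus>j \<in> B. f a j \<oplus> (\<Oplus>i \<in> A. f i j))"
    using insert by (intro finsum_cong) (auto simp: simp_implies_def finsum_insert intro!: finsum_closed)
  ultimately show ?case
    using insert by (simp add: finsum_insert finsum_addf finsum_closed)
qed


lemma (in abelian_group) eq_if_minus_zero: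
  assumes "x \<ominus> y = \<zero>" "x \<in> carrier G" "y \<in> carrier G"
  shows "x = y"
  using assms minus_equality[of x "\<ominus> y"] by (simp add: minus_eq)


section \<open>The Leibniz expression of a list\<close>

context nonunital_ring
begin

lemma l_null: "x \<in> carrier R \<Longrightarrow> \<zero> \<otimes> x = \<zero>"
  by (rule additive_zero[where f = "\<lambda>y. y \<otimes> x" and A = R])
    (auto simp: m_closed l_distr abelian_group_axioms)

lemma r_null: "x \<in> carrier R \<Longrightarrow> x \<otimes> \<zero> = \<zero>"
  by (rule additive_zero[where A = R])
    (auto simp: m_closed r_distr abelian_group_axioms)

lemma l_minus: "\<lbrakk>x \<in> carrier R; y \<in> carrier R\<rbrakk> \<Longrightarrow> (\<ominus> x) \<otimes> y = \<ominus> (x \<otimes> y)"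
  using l_distr[of "\<ominus> x" x y] by (simp add: l_null l_neg m_closed minus_equality)

lemma r_minus: "\<lbrakk>x \<in> carrier R; y \<in> carrier R\<rbrakk> \<Longrightarrow> x \<otimes> (\<ominus> y) = \<ominus> (x \<otimes> y)"
  using r_distr[of "\<ominus> y" y x] by (simp add: r_null l_neg m_closed minus_equality)

section \<open>Products of nonempty lists\<close>

lemma list_prod_singleton [simp]: "list_prod R [x] = x"
  by (simp add: list_prod_def)

lemma list_prod_closed: "\<lbrakk>xs \<noteq> []; set xs \<subseteq> carrier R\<rbrakk> \<Longrightarrow> list_prod R xs \<in> carrier R"
proof -
  have "x \<in> carrier R \<Longrightarrow> set ys \<subseteq> carrier R \<Longrightarrow> foldl (\<otimes>) x ys \<in> carrier R" for x ys
    by (induction ys arbitrary: x) (auto simp: m_closed)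
  then show "\<lbrakk>xs \<noteq> []; set xs \<subseteq> carrier R\<rbrakk> \<Longrightarrow> ?thesis"
    by (cases xs) (auto simp: list_prod_def)
qed

lemma list_prod_Cons:
  assumes "xs \<noteq> []" "x \<in> carrier R" "set xs \<subseteq> carrier R"
  shows "list_prod R (x # xs) = x \<otimes> list_prod R xs"
proof -
  have *: "\<lbrakk>x \<in> carrier R; y \<in> carrier R; set ys \<subseteq> carrier R\<rbrakk>
      \<Longrightarrow> foldl (\<otimes>) (x \<otimes> y) ys = x \<otimes> foldl (\<otimes>) y ys" for x y ys
    by (induction ys arbitrary: y) (auto simp: m_closed m_assoc)
  show ?thesis using assms by (cases xs) (auto simp: list_prod_def *)
qed

lemma list_prod_snoc: "xs \<noteq> [] \<Longrightarrow> list_prod R (xs @ [x]) = list_prod R xs \<otimes> x"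
  by (cases xs) (auto simp: list_prod_def)

text \<open>Absorbs a factor into the head without changing the number of factors. This matters
  because the derivation rule is available for one fixed length only.\<close>

lemma list_prod_mult_hd:
  assumes "x \<in> carrier R" "y \<in> carrier R" "set ys \<subseteq> carrier R"
  shows "list_prod R ((x \<otimes> y) # ys) = x \<otimes> list_prod R (y # ys)"
  using assms by (cases "ys = []") (simp_all add: list_prod_Cons m_assoc m_closed list_prod_closed)

lemma list_prod_add_hd:
  assumes "x \<in> carrier R" "y \<in> carrier R" "set ys \<subseteq> carrier R"
  shows "list_prod R ((x \<oplus> y) # ys) = list_prod R (x # ys) \<oplus> list_prod R (y # ys)"
  using assms by (cases "ys = []") (simp_all add: list_prod_Cons l_distr list_prod_closed)

text \<open>The right-hand side of the derivation rule, taken for lists of every length. Thus the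
  parts of a product of \<open>m\<close> factors can be treated separately, although
  \<open>d\<close> of such a part need not be given by this formula.\<close>

definition leibniz :: "('a \<Rightarrow> 'a) \<Rightarrow> 'a list \<Rightarrow> 'a" where
  "leibniz d xs = (\<Oplus>i \<in> {..<length xs}. list_prod R (xs[i := d (xs ! i)]))"

lemma list_prod_update_closed:
  assumes "d \<in> carrier R \<rightarrow> carrier R" "set xs \<subseteq> carrier R" "i < length xs"
  shows "list_prod R (xs[i := d (xs ! i)]) \<in> carrier R"
proof (rule list_prod_closed)
  show "xs[i := d (xs ! i)] \<noteq> []" using assms(3) by auto
  have "xs ! i \<in> carrier R" using assms by auto
  then have "d (xs ! i) \<in> carrier R" using assms(1) by auto
  then show "set (xs[i := d (xs ! i)]) \<subseteq> carrier R"
    using assms(2) by (meson insert_subset order_trans set_update_subset_insert)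
qed

lemma leibniz_closed:
  "\<lbrakk>d \<in> carrier R \<rightarrow> carrier R; set xs \<subseteq> carrier R\<rbrakk> \<Longrightarrow> leibniz d xs \<in> carrier R"
  unfolding leibniz_def by (rule finsum_closed) (auto intro: list_prod_update_closed)

lemma leibniz_singleton:
  "\<lbrakk>d \<in> carrier R \<rightarrow> carrier R; x \<in> carrier R\<rbrakk> \<Longrightarrow> leibniz d [x] = d x"
  using finsum_insert[of "{}" 0 "\<lambda>i. list_prod R ([x][i := d ([x] ! i)])"]
  by (auto simp: leibniz_def lessThan_Suc Pi_iff)

text \<open>Index 0 gives the first term. Every later index leaves the head \<open>x\<close>
  untouched, so \<open>x\<close> comes out of the remaining sum. The tail is nonempty because an
  empty product has no meaning here.\<close>

lemma leibniz_Cons: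
  assumes d: "d \<in> carrier R \<rightarrow> carrier R" and xs: "xs \<noteq> []" "set xs \<subseteq> carrier R"
    and x: "x \<in> carrier R"
  shows "leibniz d (x # xs) = d x \<otimes> list_prod R xs \<oplus> x \<otimes> leibniz d xs"
proof -
  define f where "f = (\<lambda>i. list_prod R ((x # xs)[i := d ((x # xs) ! i)]))"
  have dx: "d x \<in> carrier R" using d x by auto
  have f0: "f 0 = d x \<otimes> list_prod R xs" using xs dx by (simp add: f_def list_prod_Cons)
  have fS: "f (Suc i) = x \<otimes> list_prod R (xs[i := d (xs ! i)])" if "i < length xs" for i
  proof -
    have "xs ! i \<in> carrier R" using xs(2) that by auto
    then have "d (xs ! i) \<in> carrier R" using d by auto
    then have "set (xs[i := d (xs ! i)]) \<subseteq> carrier R"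
      using xs(2) by (meson insert_subset order_trans set_update_subset_insert)
    then show ?thesis using x xs(1) by (simp add: f_def list_prod_Cons)
  qed
  have c: "list_prod R (xs[i := d (xs ! i)]) \<in> carrier R" if "i < length xs" for i
    using list_prod_update_closed d xs that by blast
  have "leibniz d (x # xs) = (\<Oplus>i \<in> insert 0 (Suc ` {..<length xs}). f i)"
    by (simp only: leibniz_def f_def length_Cons lessThan_Suc_eq_insert_0)
  also have "\<dots> = f 0 \<oplus> (\<Oplus>i \<in> Suc ` {..<length xs}. f i)"
    using fS c x f0 dx xs list_prod_closed[OF xs] by (intro finsum_insert) (auto intro!: m_closed)
  also have "(\<Oplus>i \<in> Suc ` {..<length xs}. f i) = (\<Oplus>i \<in> {..<length xs}. f (Suc i))"
    using fS c x by (intro finsum_reindex) (auto intro!: m_closed)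
  also have "\<dots> = (\<Oplus>i \<in> {..<length xs}. x \<otimes> list_prod R (xs[i := d (xs ! i)]))"
    using fS c x by (intro finsum_cong) (auto simp: simp_implies_def intro!: m_closed)
  also have "\<dots> = x \<otimes> leibniz d xs"
    unfolding leibniz_def using c x
    by (intro additive_finsum[symmetric]) (auto simp: abelian_group_axioms r_distr m_closed)
  finally show ?thesis by (simp add: f0)
qed

lemma leibniz_snoc:
  assumes d: "d \<in> carrier R \<rightarrow> carrier R" and xs: "xs \<noteq> []" "set xs \<subseteq> carrier R"
    and x: "x \<in> carrier R"
  shows "leibniz d (xs @ [x]) = leibniz d xs \<otimes> x \<oplus> list_prod R xs \<otimes> d x"
  using xs
proof (induction xs)
  case (Cons y ys)
  have dx: "d x \<in> carrier R" "d y \<in> carrier R" using Cons d x by auto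
  show ?case
  proof (cases "ys = []")
    case True
    then show ?thesis using Cons dx x d by (simp add: leibniz_Cons leibniz_singleton)
  next
    case False
    have c: "y \<in> carrier R" "list_prod R ys \<in> carrier R" "leibniz d ys \<in> carrier R"
      using Cons False d by (auto intro: list_prod_closed leibniz_closed)
    have "leibniz d ((y # ys) @ [x]) =
        d y \<otimes> (list_prod R ys \<otimes> x) \<oplus> y \<otimes> (leibniz d ys \<otimes> x \<oplus> list_prod R ys \<otimes> d x)"
      using Cons False x d by (simp add: leibniz_Cons list_prod_snoc)
    then show ?thesis using Cons False x d dx c
      by (simp add: leibniz_Cons list_prod_Cons l_distr r_distr m_assoc m_closed a_assoc)
  qed
qed simp

text \<open>The head enters only through itself and through its image under \<open>d\<close>, so
  additivity of \<open>d\<close> at this single pair is enough.\<close>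

lemma leibniz_add_hd:
  assumes d: "d \<in> carrier R \<rightarrow> carrier R" and ys: "set ys \<subseteq> carrier R"
    and x: "x \<in> carrier R" "y \<in> carrier R" and eq: "d (x \<oplus> y) = d x \<oplus> d y"
  shows "leibniz d ((x \<oplus> y) # ys) = leibniz d (x # ys) \<oplus> leibniz d (y # ys)"
proof (cases "ys = []")
  case True
  then show ?thesis using x eq d by (simp add: leibniz_singleton)
next
  case False
  have c: "d x \<in> carrier R" "d y \<in> carrier R" "list_prod R ys \<in> carrier R" "leibniz d ys \<in> carrier R"
    using False ys d x by (auto intro: list_prod_closed leibniz_closed)
  then show ?thesis using False ys d x eq
    by (simp add: leibniz_Cons l_distr m_closed a_ac)
qed

end


section \<open>Multiplicative derivations of rings with a Peirce-like decomposition\<close>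

text \<open>Abstracts the behaviour of single-entry matrices: \<open>P i j\<close> acts like a
  Peirce component, but there are no idempotents. Instead of projecting with idempotents one
  multiplies by diagonal elements on both sides (\<open>P_corner\<close>), and an element is
  determined by these corners (\<open>P_nondegenerate\<close>).\<close>

locale peirce_ring = nonunital_ring R for R (structure) +
  fixes I :: "'i set" and P :: "'i \<Rightarrow> 'i \<Rightarrow> 'a set"
  assumes P_subset: "\<lbrakk>i \<in> I; j \<in> I\<rbrakk> \<Longrightarrow> P i j \<subseteq> carrier R"
    and P_mult: "\<lbrakk>i \<in> I; j \<in> I; k \<in> I; x \<in> P i j; y \<in> P j k\<rbrakk> \<Longrightarrow> x \<otimes> y \<in> P i k"
    and P_orthogonal: "\<lbrakk>i \<in> I; j \<in> I; k \<in> I; l \<in> I; j \<noteq> k; x \<in> P i j; y \<in> P k l\<rbrakk>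
      \<Longrightarrow> x \<otimes> y = \<zero>"
    and P_corner: "\<lbrakk>k \<in> I; l \<in> I; a \<in> P k k; b \<in> P l l; x \<in> carrier R\<rbrakk>
      \<Longrightarrow> a \<otimes> (x \<otimes> b) \<in> P k l"
    and P_nondegenerate: "\<lbrakk>x \<in> carrier R;
        \<And>k l a b. \<lbrakk>k \<in> I; l \<in> I; a \<in> P k k; b \<in> P l l\<rbrakk> \<Longrightarrow> a \<otimes> (x \<otimes> b) = \<zero>\<rbrakk> \<Longrightarrow> x = \<zero>"
    and P_faithful: "\<lbrakk>i \<in> I; k \<in> I; i \<noteq> k; x \<in> P i i; \<And>z. z \<in> P i k \<Longrightarrow> x \<otimes> z = \<zero>\<rbrakk>
      \<Longrightarrow> x = \<zero>"
begin

section \<open>Cancelling products of elements of the diagonal components\<close>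

lemma P_carrier: "\<lbrakk>x \<in> P i j; i \<in> I; j \<in> I\<rbrakk> \<Longrightarrow> x \<in> carrier R"
  using P_subset by blast

lemma diagonal_subset: "\<lbrakk>set as \<subseteq> P k k; k \<in> I\<rbrakk> \<Longrightarrow> set as \<subseteq> carrier R"
  using P_subset by blast

lemma list_prod_P: "\<lbrakk>as \<noteq> []; set as \<subseteq> P k k; k \<in> I\<rbrakk> \<Longrightarrow> list_prod R as \<in> P k k"
proof (induction as)
  case (Cons a as)
  then have "set as \<subseteq> carrier R" "a \<in> carrier R" using P_subset[of k k] by auto
  with Cons show ?case
    by (cases "as = []") (auto simp: list_prod_Cons intro: P_mult[of k k k])
qed simp

lemma list_prod_P_hd:
  assumes "x \<in> P i k" "set as \<subseteq> P k k" "i \<in> I" "k \<in> I"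
  shows "list_prod R (x # as) \<in> P i k"
  using assms diagonal_subset[of as k] P_carrier[of x i k]
  by (cases "as = []") (simp_all add: list_prod_Cons P_mult[of i k k] list_prod_P)

text \<open>Each \<open>a\<close> kills the difference of \<open>x\<close> and \<open>y\<close> from
  the left, so all corners of that difference vanish.\<close>

lemma cancel_left1:
  assumes x: "x \<in> carrier R" "y \<in> carrier R"
    and eq: "\<And>k a. \<lbrakk>k \<in> I; a \<in> P k k\<rbrakk> \<Longrightarrow> a \<otimes> x = a \<otimes> y"
  shows "x = y"
proof -
  have "x \<ominus> y = \<zero>"
  proof (rule P_nondegenerate)
    fix k l a b assume kl: "k \<in> I" "l \<in> I" "a \<in> P k k" "b \<in> P l l"
    then have c: "a \<in> carrier R" "b \<in> carrier R" by (auto intro: P_carrier)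
    have "a \<otimes> ((x \<ominus> y) \<otimes> b) = (a \<otimes> x \<ominus> a \<otimes> y) \<otimes> b"
      using x c by (simp add: minus_eq m_assoc[symmetric] r_distr r_minus m_closed)
    then show "a \<otimes> ((x \<ominus> y) \<otimes> b) = \<zero>"
      using x c eq[OF kl(1,3)] by (simp add: minus_eq r_neg l_null m_closed)
  qed (use x in simp)
  then show ?thesis using x by (rule eq_if_minus_zero)
qed

lemma cancel_right1:
  assumes x: "x \<in> carrier R" "y \<in> carrier R"
    and eq: "\<And>l b. \<lbrakk>l \<in> I; b \<in> P l l\<rbrakk> \<Longrightarrow> x \<otimes> b = y \<otimes> b"
  shows "x = y"
proof -
  have "x \<ominus> y = \<zero>"
  proof (rule P_nondegenerate)
    fix k l a b assume kl: "k \<in> I" "l \<in> I" "a \<in> P k k" "b \<in> P l l"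
    then have c: "a \<in> carrier R" "b \<in> carrier R" by (auto intro: P_carrier)
    have "a \<otimes> ((x \<ominus> y) \<otimes> b) = a \<otimes> (x \<otimes> b \<ominus> y \<otimes> b)"
      using x c by (simp add: minus_eq l_distr l_minus m_closed)
    then show "a \<otimes> ((x \<ominus> y) \<otimes> b) = \<zero>"
      using x c eq[OF kl(2,4)] by (simp add: minus_eq r_neg r_null m_closed)
  qed (use x in simp)
  then show ?thesis using x by (rule eq_if_minus_zero)
qed

text \<open>Induction on the length, peeling off the last factor \<open>a\<close> and applying the
  induction hypothesis to \<open>a x\<close> and \<open>a y\<close>. Lists from one diagonal
  component suffice: if \<open>a\<close> comes from another component than the preceding factors,
  the product is zero anyway.\<close>

lemma cancel_left:
  assumes "x \<in> carrier R" "y \<in> carrier R"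
    and "\<And>k as. \<lbrakk>k \<in> I; length as = Suc r; set as \<subseteq> P k k\<rbrakk>
      \<Longrightarrow> list_prod R as \<otimes> x = list_prod R as \<otimes> y"
  shows "x = y"
  using assms
proof (induction r arbitrary: x y)
  case 0
  show ?case
  proof (rule cancel_left1)
    show "a \<otimes> x = a \<otimes> y" if "k \<in> I" "a \<in> P k k" for k a
      using 0(3)[of k "[a]"] that by simp
  qed (use 0(1,2) in auto)
next
  case (Suc r)
  show ?case
  proof (rule cancel_left1)
    fix p a assume p: "p \<in> I" "a \<in> P p p"
    then have a: "a \<in> carrier R" by (auto intro: P_carrier)
    show "a \<otimes> x = a \<otimes> y"
    proof (rule Suc.IH)
      fix k as assume k: "k \<in> I" "length as = Suc r" "set as \<subseteq> P k k"
      then have ne: "as \<noteq> []" by auto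
      have P: "list_prod R as \<in> P k k" using k ne by (intro list_prod_P)
      then have c: "list_prod R as \<in> carrier R" using k by (auto intro: P_carrier)
      have "list_prod R as \<otimes> a \<otimes> x = list_prod R as \<otimes> a \<otimes> y"
      proof (cases "k = p")
        case True
        then show ?thesis
          using Suc.prems(3)[of k "as @ [a]"] k p ne by (simp add: list_prod_snoc)
      next
        case False
        then show ?thesis using P_orthogonal[of k k p p] P k p Suc.prems(1,2) by (simp add: l_null)
      qed
      then show "list_prod R as \<otimes> (a \<otimes> x) = list_prod R as \<otimes> (a \<otimes> y)"
        using c a Suc.prems(1,2) by (simp add: m_assoc)
    qed (use a Suc.prems(1,2) in \<open>auto intro: m_closed\<close>)
  qed (use Suc.prems(1,2) in auto)
qed

lemma cancel_right:
  assumes "x \<in> carrier R" "y \<in> carrier R"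
    and "\<And>l bs. \<lbrakk>l \<in> I; length bs = Suc r; set bs \<subseteq> P l l\<rbrakk>
      \<Longrightarrow> x \<otimes> list_prod R bs = y \<otimes> list_prod R bs"
  shows "x = y"
  using assms
proof (induction r arbitrary: x y)
  case 0
  show ?case
  proof (rule cancel_right1)
    show "x \<otimes> b = y \<otimes> b" if "l \<in> I" "b \<in> P l l" for l b
      using 0(3)[of l "[b]"] that by simp
  qed (use 0(1,2) in auto)
next
  case (Suc r)
  show ?case
  proof (rule cancel_right1)
    fix p b assume p: "p \<in> I" "b \<in> P p p"
    then have b: "b \<in> carrier R" by (auto intro: P_carrier)
    show "x \<otimes> b = y \<otimes> b"
    proof (rule Suc.IH)
      fix l bs assume l: "l \<in> I" "length bs = Suc r" "set bs \<subseteq> P l l"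
      then have ne: "bs \<noteq> []" by auto
      have P: "list_prod R bs \<in> P l l" using l ne by (intro list_prod_P)
      then have c: "list_prod R bs \<in> carrier R" using l by (auto intro: P_carrier)
      have "x \<otimes> (b \<otimes> list_prod R bs) = y \<otimes> (b \<otimes> list_prod R bs)"
      proof (cases "l = p")
        case True
        then show ?thesis
          using Suc.prems(3)[of l "b # bs"] l p b ne diagonal_subset[of bs l]
          by (simp add: list_prod_Cons)
      next
        case False
        then show ?thesis using P_orthogonal[of p p l l] P l p Suc.prems(1,2) by (simp add: r_null)
      qed
      then show "x \<otimes> b \<otimes> list_prod R bs = y \<otimes> b \<otimes> list_prod R bs"
        using c b Suc.prems(1,2) by (simp add: m_assoc)
    qed (use b Suc.prems(1,2) in \<open>auto intro: m_closed\<close>)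
  qed (use Suc.prems(1,2) in auto)
qed

text \<open>The form in which cancellation meets the derivation: with \<open>r = s\<close> and
  \<open>m = r + 2\<close>, each side carries a product of \<open>m - 1\<close> factors.\<close>

lemma cancel_both:
  assumes x: "x \<in> carrier R" "y \<in> carrier R"
    and eq: "\<And>k l as bs. \<lbrakk>k \<in> I; l \<in> I; length as = Suc r; set as \<subseteq> P k k;
        length bs = Suc s; set bs \<subseteq> P l l\<rbrakk>
      \<Longrightarrow> list_prod R as \<otimes> (x \<otimes> list_prod R bs) = list_prod R as \<otimes> (y \<otimes> list_prod R bs)"
  shows "x = y"
proof (rule cancel_right[where r = s])
  fix l bs assume l: "l \<in> I" "length bs = Suc s" "set bs \<subseteq> P l l"
  then have "list_prod R bs \<in> carrier R"
    by (intro list_prod_closed diagonal_subset) auto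
  then have c: "x \<otimes> list_prod R bs \<in> carrier R" "y \<otimes> list_prod R bs \<in> carrier R"
    using x by (simp_all add: m_closed)
  show "x \<otimes> list_prod R bs = y \<otimes> list_prod R bs"
    by (rule cancel_left[where r = r, OF c]) (rule eq[OF _ l(1) _ _ l(2,3)])
qed fact+

end

section \<open>Additivity of a multiplicative derivation\<close>

locale peirce_derivation = peirce_ring +
  fixes d :: "'a \<Rightarrow> 'a" and r :: nat
  assumes derivation: "multiplicative_derivation (Suc (Suc r)) R d"
begin

lemma d_closed: "d \<in> carrier R \<rightarrow> carrier R"
  using derivation by (simp add: multiplicative_derivation_def)

lemma d_carrier [simp]: "x \<in> carrier R \<Longrightarrow> d x \<in> carrier R"
  using d_closed by auto

lemma d_list_prod:
  "\<lbrakk>length xs = Suc (Suc r); set xs \<subseteq> carrier R\<rbrakk> \<Longrightarrow> d (list_prod R xs) = leibniz d xs"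
  using derivation by (simp add: multiplicative_derivation_def leibniz_def)

text \<open>With \<open>m = Suc (Suc r)\<close>, the list \<open>bs\<close> supplies the other
  \<open>m - 1\<close> factors. For fixed \<open>bs\<close> this is a two-factor product rule in
  \<open>x\<close>, with \<open>leibniz d bs\<close> in place of the derivative of the second
  factor.\<close>

lemma d_right:
  assumes "length bs = Suc r" "set bs \<subseteq> carrier R" "x \<in> carrier R"
  shows "d (x \<otimes> list_prod R bs) = d x \<otimes> list_prod R bs \<oplus> x \<otimes> leibniz d bs"
proof -
  have "bs \<noteq> []" using assms by auto
  then show ?thesis
    using assms d_list_prod[of "x # bs"] d_closed by (simp add: list_prod_Cons leibniz_Cons)
qed

lemma d_left:
  assumes "length as = Suc r" "set as \<subseteq> carrier R" "x \<in> carrier R"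
  shows "d (list_prod R as \<otimes> x) = leibniz d as \<otimes> x \<oplus> list_prod R as \<otimes> d x"
proof -
  have "as \<noteq> []" using assms by auto
  then show ?thesis
    using assms d_list_prod[of "as @ [x]"] d_closed by (simp add: list_prod_snoc leibniz_snoc)
qed

lemma d_zero: "d \<zero> = \<zero>"
proof -
  define zs where "zs = \<zero> # replicate r \<zero>"
  have zs: "length zs = Suc r" "set zs \<subseteq> carrier R" by (auto simp: zs_def)
  \<comment> \<open>Replacing the head zero by a product of two zeros lets a zero be pulled out in
    front, so the product of \<open>zs\<close> vanishes also when \<open>r = 0\<close>.\<close>
  have "list_prod R ((\<zero> \<otimes> \<zero>) # replicate r \<zero>) = \<zero> \<otimes> list_prod R zs"
    unfolding zs_def by (intro list_prod_mult_hd) auto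
  moreover have "list_prod R zs \<in> carrier R" using zs by (intro list_prod_closed) auto
  ultimately have z: "list_prod R zs = \<zero>" by (simp add: l_null zs_def)
  show ?thesis
    using d_right[OF zs, of \<zero>] zs d_closed by (simp add: z l_null r_null leibniz_closed)
qed

text \<open>Applying the product rule on both sides gives \<open>d (A z B) = A (d z) B + h z\<close>
  with \<open>h\<close> additive in \<open>z\<close>. The contributions of \<open>h\<close> cancel,
  so additivity at the sandwiched pair passes to the sandwiched defect.\<close>

lemma d_add_sandwich:
  assumes x: "x \<in> carrier R" "y \<in> carrier R"
    and as: "length as = Suc r" "set as \<subseteq> carrier R" and bs: "length bs = Suc r" "set bs \<subseteq> carrier R"
    and eq: "d (list_prod R as \<otimes> (x \<otimes> list_prod R bs) \<oplus> list_prod R as \<otimes> (y \<otimes> list_prod R bs))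
        = d (list_prod R as \<otimes> (x \<otimes> list_prod R bs)) \<oplus> d (list_prod R as \<otimes> (y \<otimes> list_prod R bs))"
  shows "list_prod R as \<otimes> (d (x \<oplus> y) \<otimes> list_prod R bs)
    = list_prod R as \<otimes> ((d x \<oplus> d y) \<otimes> list_prod R bs)"
proof -
  define A B S T where "A = list_prod R as" and "B = list_prod R bs"
    and "S = leibniz d as" and "T = leibniz d bs"
  have c [simp]: "A \<in> carrier R" "B \<in> carrier R" "S \<in> carrier R" "T \<in> carrier R"
    unfolding A_def B_def S_def T_def
    using as bs d_closed by (auto intro!: list_prod_closed leibniz_closed)
  \<comment> \<open>The two terms in which the derivation hits \<open>A\<close> or \<open>B\<close>
    rather than \<open>z\<close>; here \<open>z\<close> itself occurs linearly.\<close>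
  define h where "h z = S \<otimes> (z \<otimes> B) \<oplus> A \<otimes> (z \<otimes> T)" for z
  have h_closed [simp]: "z \<in> carrier R \<Longrightarrow> h z \<in> carrier R" for z
    by (simp add: h_def m_closed)
  have h_add: "h (x \<oplus> y) = h x \<oplus> h y"
    using x by (simp add: h_def m_closed l_distr r_distr a_ac)
  have d_both: "d (A \<otimes> (z \<otimes> B)) = A \<otimes> (d z \<otimes> B) \<oplus> h z" if "z \<in> carrier R" for z
    using that d_left[OF as, of "z \<otimes> B"] d_right[OF bs, of z]
    by (simp add: h_def A_def[symmetric] B_def[symmetric] S_def[symmetric] T_def[symmetric]
        m_closed r_distr a_ac)
  have "A \<otimes> (d (x \<oplus> y) \<otimes> B) \<oplus> h (x \<oplus> y) = d (A \<otimes> (x \<otimes> B) \<oplus> A \<otimes> (y \<otimes> B))"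
    using x d_both[of "x \<oplus> y"] by (simp add: l_distr r_distr m_closed)
  also have "\<dots> = d (A \<otimes> (x \<otimes> B)) \<oplus> d (A \<otimes> (y \<otimes> B))"
    unfolding A_def B_def by (rule eq)
  also have "\<dots> = (A \<otimes> (d x \<otimes> B) \<oplus> h x) \<oplus> (A \<otimes> (d y \<otimes> B) \<oplus> h y)"
    using x by (simp add: d_both)
  also have "\<dots> = (A \<otimes> (d x \<otimes> B) \<oplus> A \<otimes> (d y \<otimes> B)) \<oplus> (h x \<oplus> h y)"
    using x by (simp add: a_ac m_closed)
  also have "\<dots> = A \<otimes> ((d x \<oplus> d y) \<otimes> B) \<oplus> h (x \<oplus> y)"
    using x by (simp add: h_add l_distr r_distr m_closed)
  finally have "A \<otimes> (d (x \<oplus> y) \<otimes> B) \<oplus> h (x \<oplus> y) = A \<otimes> ((d x \<oplus> d y) \<otimes> B) \<oplus> h (x \<oplus> y)" .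
  moreover have "A \<otimes> (d (x \<oplus> y) \<otimes> B) \<in> carrier R" "A \<otimes> ((d x \<oplus> d y) \<otimes> B) \<in> carrier R"
      "h (x \<oplus> y) \<in> carrier R"
    using x by (simp_all add: m_closed)
  ultimately have "A \<otimes> (d (x \<oplus> y) \<otimes> B) = A \<otimes> ((d x \<oplus> d y) \<otimes> B)"
    by (simp only: add.right_cancel)
  then show ?thesis by (simp only: A_def B_def)
qed

text \<open>Reduces additivity at \<open>x\<close> and \<open>y\<close> to additivity at their
  corners. Every later case either makes corners vanish or places them in a component already
  treated.\<close>

lemma d_addI:
  assumes x: "x \<in> carrier R" "y \<in> carrier R"
    and eq: "\<And>k l as bs. \<lbrakk>k \<in> I; l \<in> I; length as = Suc r; set as \<subseteq> P k k;
        length bs = Suc r; set bs \<subseteq> P l l\<rbrakk>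
      \<Longrightarrow> d (list_prod R as \<otimes> (x \<otimes> list_prod R bs) \<oplus> list_prod R as \<otimes> (y \<otimes> list_prod R bs))
        = d (list_prod R as \<otimes> (x \<otimes> list_prod R bs)) \<oplus> d (list_prod R as \<otimes> (y \<otimes> list_prod R bs))"
  shows "d (x \<oplus> y) = d x \<oplus> d y"
proof (rule cancel_both[where r = r and s = r])
  fix k l as bs
  assume h: "k \<in> I" "l \<in> I" "length as = Suc r" "set as \<subseteq> P k k" "length bs = Suc r" "set bs \<subseteq> P l l"
  with x eq[OF h] show "list_prod R as \<otimes> (d (x \<oplus> y) \<otimes> list_prod R bs)
      = list_prod R as \<otimes> ((d x \<oplus> d y) \<otimes> list_prod R bs)"
    by (intro d_add_sandwich) (auto dest: diagonal_subset)
qed (use x in auto)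

lemma sandwich_off_corner:
  assumes "i \<in> I" "j \<in> I" "p \<in> I" "q \<in> I" "p \<noteq> i \<or> q \<noteq> j" "A \<in> P p p" "B \<in> P q q" "x \<in> P i j"
  shows "A \<otimes> (x \<otimes> B) = \<zero>"
proof -
  have c: "A \<in> carrier R" "B \<in> carrier R" "x \<in> carrier R"
    using assms by (auto intro: P_carrier)
  consider "A \<otimes> x = \<zero>" | "x \<otimes> B = \<zero>"
    using assms P_orthogonal by metis
  then show ?thesis by cases (use c in \<open>simp_all add: m_assoc[symmetric] l_null r_null\<close>)
qed

text \<open>The index \<open>q\<close> of the right factor cannot equal both \<open>j\<close> and
  \<open>k\<close>, so one of the two sandwiches is zero and \<open>d_zero\<close> finishes.\<close>

lemma d_add_row:
  assumes i: "i \<in> I" "j \<in> I" "k \<in> I" "j \<noteq> k" and x: "x \<in> P i j" and y: "y \<in> P i k"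
  shows "d (x \<oplus> y) = d x \<oplus> d y"
proof (rule d_addI)
  show c: "x \<in> carrier R" "y \<in> carrier R" using assms by (auto intro: P_carrier)
  fix p q as bs
  assume h: "p \<in> I" "q \<in> I" "length as = Suc r" "set as \<subseteq> P p p" "length bs = Suc r" "set bs \<subseteq> P q q"
  let ?A = "list_prod R as" and ?B = "list_prod R bs"
  have A: "?A \<in> P p p" and B: "?B \<in> P q q" using h by (auto intro!: list_prod_P)
  then have AB: "?A \<in> carrier R" "?B \<in> carrier R" using h by (auto intro: P_carrier)
  consider "x \<otimes> ?B = \<zero>" | "y \<otimes> ?B = \<zero>"
    using i x y h(2) B P_orthogonal by metis
  then show "d (?A \<otimes> (x \<otimes> ?B) \<oplus> ?A \<otimes> (y \<otimes> ?B)) = d (?A \<otimes> (x \<otimes> ?B)) \<oplus> d (?A \<otimes> (y \<otimes> ?B))"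
    by cases (use AB c in \<open>simp_all add: m_closed r_null d_zero\<close>)
qed

lemma d_add_column:
  assumes i: "i \<in> I" "j \<in> I" "k \<in> I" "j \<noteq> k" and x: "x \<in> P j i" and y: "y \<in> P k i"
  shows "d (x \<oplus> y) = d x \<oplus> d y"
proof (rule d_addI)
  show c: "x \<in> carrier R" "y \<in> carrier R" using assms by (auto intro: P_carrier)
  fix p q as bs
  assume h: "p \<in> I" "q \<in> I" "length as = Suc r" "set as \<subseteq> P p p" "length bs = Suc r" "set bs \<subseteq> P q q"
  let ?A = "list_prod R as" and ?B = "list_prod R bs"
  have A: "?A \<in> P p p" and B: "?B \<in> P q q" using h by (auto intro!: list_prod_P)
  then have AB: "?A \<in> carrier R" "?B \<in> carrier R" using h by (auto intro: P_carrier)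
  consider "?A \<otimes> x = \<zero>" | "?A \<otimes> y = \<zero>"
    using i x y h(1) A P_orthogonal by metis
  then show "d (?A \<otimes> (x \<otimes> ?B) \<oplus> ?A \<otimes> (y \<otimes> ?B)) = d (?A \<otimes> (x \<otimes> ?B)) \<oplus> d (?A \<otimes> (y \<otimes> ?B))"
    by cases (use AB c in \<open>simp_all add: m_assoc[symmetric] m_closed l_null d_zero\<close>)
qed

text \<open>Both products lie in \<open>P i j\<close>, and their sum factors as
  \<open>(a + y) (U + B)\<close> because the cross terms vanish. Additivity is already known at both
  sums involved: \<open>a\<close> and \<open>y\<close> share a row, \<open>x\<close> and
  \<open>b\<close> share a column.\<close>

lemma d_add_products:
  assumes i: "i \<in> I" "j \<in> I" "i \<noteq> j" and a: "a \<in> P i i" and b: "b \<in> P j j"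
    and x: "x \<in> P i j" and y: "y \<in> P i j" and cs: "set cs \<subseteq> P j j" "length cs = r"
  shows "d (a \<otimes> list_prod R (x # cs) \<oplus> y \<otimes> list_prod R (b # cs))
    = d (a \<otimes> list_prod R (x # cs)) \<oplus> d (y \<otimes> list_prod R (b # cs))"
proof -
  define U where "U = list_prod R (x # cs)"
  define B where "B = list_prod R (b # cs)"
  define S where "S = leibniz d (x # cs)"
  define T where "T = leibniz d (b # cs)"
  have cs': "set cs \<subseteq> carrier R" using cs i by (auto dest: diagonal_subset)
  have c [simp]: "a \<in> carrier R" "b \<in> carrier R" "x \<in> carrier R" "y \<in> carrier R"
    using assms by (auto intro: P_carrier)
  have C [simp]: "U \<in> carrier R" "B \<in> carrier R" "S \<in> carrier R" "T \<in> carrier R"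
    unfolding U_def B_def S_def T_def
    using cs' d_closed by (auto intro!: list_prod_closed leibniz_closed)
  have P: "U \<in> P i j" "B \<in> P j j"
    unfolding U_def B_def using i x b cs by (auto intro!: list_prod_P_hd)
  have z: "a \<otimes> B = \<zero>" "y \<otimes> U = \<zero>"
    using P i a y P_orthogonal by metis+
  have d_U: "d (u \<otimes> U) = d u \<otimes> U \<oplus> u \<otimes> S" if "u \<in> carrier R" for u
    using that d_right[of "x # cs" u] cs cs' by (simp add: U_def S_def)
  have d_B: "d (u \<otimes> B) = d u \<otimes> B \<oplus> u \<otimes> T" if "u \<in> carrier R" for u
    using that d_right[of "b # cs" u] cs cs' by (simp add: B_def T_def)
  have ay: "d (a \<oplus> y) = d a \<oplus> d y" using d_add_row[of i i j a y] i a y by simp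
  have xb: "d (x \<oplus> b) = d x \<oplus> d b" using d_add_column[of j i j x b] i b x by simp
  have UB: "list_prod R ((x \<oplus> b) # cs) = U \<oplus> B" unfolding U_def B_def
    using cs' by (intro list_prod_add_hd) auto
  have ST: "leibniz d ((x \<oplus> b) # cs) = S \<oplus> T" unfolding S_def T_def
    using cs' d_closed xb by (intro leibniz_add_hd) auto
  \<comment> \<open>The cross terms \<open>a B\<close> and \<open>y U\<close> are zero because the
    inner indices differ.\<close>
  have "a \<otimes> U \<oplus> y \<otimes> B = (a \<oplus> y) \<otimes> (U \<oplus> B)"
    using z by (simp add: l_distr r_distr m_closed)
  then have "d (a \<otimes> U \<oplus> y \<otimes> B) = (d a \<oplus> d y) \<otimes> (U \<oplus> B) \<oplus> (a \<oplus> y) \<otimes> (S \<oplus> T)"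
    using d_right[of "(x \<oplus> b) # cs" "a \<oplus> y"] cs cs' by (simp add: UB ST ay)
  \<comment> \<open>The eight terms of the expansion regroup by \<open>d_U\<close> and
    \<open>d_B\<close> into the images of four products; the two cross products contribute
    \<open>d\<close> of zero.\<close>
  also have "\<dots> = (d (a \<otimes> U) \<oplus> d (y \<otimes> B)) \<oplus> (d (a \<otimes> B) \<oplus> d (y \<otimes> U))"
    by (simp add: d_U d_B l_distr r_distr m_closed a_ac)
  finally show ?thesis using z by (simp add: d_zero m_closed U_def[symmetric] B_def[symmetric])
qed

text \<open>Only the corner at \<open>(i, j)\<close> can be nonzero. There the two sandwiches are
  rebracketed into the shape of \<open>d_add_products\<close>, with \<open>a\<close> the first
  factor on the left and \<open>b\<close> the first factor on the right.\<close>

lemma d_add_off_diagonal: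
  assumes i: "i \<in> I" "j \<in> I" "i \<noteq> j" and x: "x \<in> P i j" and y: "y \<in> P i j"
  shows "d (x \<oplus> y) = d x \<oplus> d y"
proof (rule d_addI)
  show c: "x \<in> carrier R" "y \<in> carrier R" using assms by (auto intro: P_carrier)
  fix p q as bs
  assume h: "p \<in> I" "q \<in> I" "length as = Suc r" "set as \<subseteq> P p p" "length bs = Suc r" "set bs \<subseteq> P q q"
  let ?A = "list_prod R as" and ?B = "list_prod R bs"
  have A: "?A \<in> P p p" and B: "?B \<in> P q q" using h by (auto intro!: list_prod_P)
  then have AB: "?A \<in> carrier R" "?B \<in> carrier R" using h by (auto intro: P_carrier)
  show "d (?A \<otimes> (x \<otimes> ?B) \<oplus> ?A \<otimes> (y \<otimes> ?B)) = d (?A \<otimes> (x \<otimes> ?B)) \<oplus> d (?A \<otimes> (y \<otimes> ?B))"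
  proof (cases "p = i \<and> q = j")
    case False
    then have "?A \<otimes> (z \<otimes> ?B) = \<zero>" if "z \<in> P i j" for z
      using that i h A B by (intro sandwich_off_corner[of i j p q]) auto
    then show ?thesis using x y by (simp add: d_zero)
  next
    case True
    obtain a as' where as: "as = a # as'" using h(3) by (cases as) auto
    obtain b cs where bs: "bs = b # cs" using h(5) by (cases bs) auto
    have ab: "a \<in> P i i" "b \<in> P j j" "set as' \<subseteq> P i i" "set cs \<subseteq> P j j" "length cs = r"
      using h as bs True by auto
    have cc: "a \<in> carrier R" "b \<in> carrier R" "set as' \<subseteq> carrier R" "set cs \<subseteq> carrier R"
      using ab i P_subset by blast+
    \<comment> \<open>All left factors after \<open>a\<close> are absorbed into \<open>x'\<close>;
      when \<open>m = 2\<close> there are none and \<open>x' = x\<close>.\<close>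
    have "\<exists>x' \<in> P i j. ?A \<otimes> x = a \<otimes> x'"
    proof (cases "as' = []")
      case True
      then show ?thesis using x as by auto
    next
      case False
      then have "list_prod R as' \<otimes> x \<in> P i j" using ab i x by (intro P_mult[of i i j] list_prod_P)
      then show ?thesis using False cc c
        by (intro bexI[of _ "list_prod R as' \<otimes> x"])
          (simp_all add: as list_prod_Cons m_assoc list_prod_closed)
    qed
    then obtain x' where x': "x' \<in> P i j" "?A \<otimes> x = a \<otimes> x'" by blast
    then have x'c: "x' \<in> carrier R" using i by (auto intro: P_carrier)
    \<comment> \<open>For \<open>x\<close> only \<open>a\<close> stays outside, and \<open>b\<close>
      is merged into the head; for \<open>y\<close>, below, the whole left product stays outside.
      Both right-hand lists then have \<open>m - 1\<close> entries with the same tail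
      \<open>cs\<close>.\<close>
    have "?A \<otimes> (x \<otimes> ?B) = a \<otimes> list_prod R (x' \<otimes> b # cs)"
      using c cc AB x' x'c
      by (simp add: m_assoc[symmetric] m_closed) (simp add: m_assoc bs list_prod_mult_hd list_prod_closed)
    moreover have "?A \<otimes> (y \<otimes> ?B) = (?A \<otimes> y) \<otimes> list_prod R (b # cs)"
      using c AB by (simp add: m_assoc bs)
    moreover have "x' \<otimes> b \<in> P i j" "?A \<otimes> y \<in> P i j"
      using i x' ab y A True by (auto intro: P_mult)
    ultimately show ?thesis
      using d_add_products[of i j a b "x' \<otimes> b" "?A \<otimes> y" cs] i ab by simp
  qed
qed

text \<open>Right multiplication by elements of \<open>P i k\<close> moves the sum off the diagonal,
  where \<open>d\<close> is additive. The two candidates \<open>u\<close> and \<open>v\<close>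
  therefore act equally on \<open>P i k\<close>, and \<open>P_faithful\<close> compares their
  corners at \<open>(i, i)\<close>.\<close>

lemma d_add_diagonal:
  assumes i: "i \<in> I" "k \<in> I" "i \<noteq> k" and x: "x \<in> P i i" and y: "y \<in> P i i"
  shows "d (x \<oplus> y) = d x \<oplus> d y"
proof -
  have c [simp]: "x \<in> carrier R" "y \<in> carrier R" using assms by (auto intro: P_carrier)
  define u where "u = d (x \<oplus> y)"
  define v where "v = d x \<oplus> d y"
  have uv [simp]: "u \<in> carrier R" "v \<in> carrier R" by (simp_all add: u_def v_def)
  have z: "u \<otimes> z = v \<otimes> z" if z: "z \<in> P i k" for z
  proof (rule cancel_right[where r = r])
    have zc [simp]: "z \<in> carrier R" using z i by (auto intro: P_carrier)
    then show "u \<otimes> z \<in> carrier R" "v \<otimes> z \<in> carrier R" by (simp_all add: m_closed)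
    fix l bs assume l: "l \<in> I" "length bs = Suc r" "set bs \<subseteq> P l l"
    then obtain b cs where bs: "bs = b # cs" by (cases bs) auto
    have bc: "b \<in> P l l" "set cs \<subseteq> P l l" "length cs = r" using bs l by auto
    have bcc [simp]: "b \<in> carrier R" "set cs \<subseteq> carrier R"
      using bc l P_subset[of l l] by auto
    have B: "list_prod R bs \<in> P l l" using l by (intro list_prod_P) auto
    then have Bc [simp]: "list_prod R bs \<in> carrier R" using l by (auto intro: P_carrier)
    have "u \<otimes> (z \<otimes> list_prod R bs) = v \<otimes> (z \<otimes> list_prod R bs)"
    proof (cases "l = k")
      case False
      then have "z \<otimes> list_prod R bs = \<zero>" using P_orthogonal[of i k l l] B z i l by simp
      then show ?thesis by (simp add: r_null)
    next
      case True
      \<comment> \<open>Merging \<open>z\<close> with \<open>b\<close> keeps the list at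
        \<open>m - 1\<close> entries, so \<open>d_right\<close> applies, while \<open>Z\<close>
        equals \<open>z\<close> times the product of \<open>bs\<close> and lies in
        \<open>P i k\<close>.\<close>
      define Z where "Z = list_prod R (z \<otimes> b # cs)"
      define T where "T = leibniz d (z \<otimes> b # cs)"
      have "Z \<in> P i k" unfolding Z_def using z bc True i by (intro list_prod_P_hd P_mult) auto
      then have xy: "x \<otimes> Z \<in> P i k" "y \<otimes> Z \<in> P i k" and [simp]: "Z \<in> carrier R"
        using x y i by (auto intro: P_mult P_carrier)
      have [simp]: "T \<in> carrier R"
        unfolding T_def using d_closed by (intro leibniz_closed) (auto intro: m_closed)
      have d_Z: "d (w \<otimes> Z) = d w \<otimes> Z \<oplus> w \<otimes> T" if "w \<in> carrier R" for w
        unfolding Z_def T_def using that bc by (intro d_right) (auto intro: m_closed)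
      \<comment> \<open>Computing \<open>d ((x + y) Z)\<close> directly and through off-diagonal
        additivity gives the same remainder \<open>(x + y) T\<close>, which cancels.\<close>
      have "u \<otimes> Z \<oplus> (x \<oplus> y) \<otimes> T = d ((x \<oplus> y) \<otimes> Z)"
        by (simp add: d_Z u_def)
      also have "\<dots> = d (x \<otimes> Z) \<oplus> d (y \<otimes> Z)"
        using d_add_off_diagonal[OF i xy] by (simp add: l_distr)
      also have "\<dots> = v \<otimes> Z \<oplus> (x \<oplus> y) \<otimes> T"
        by (simp add: d_Z v_def l_distr m_closed a_ac)
      finally have "u \<otimes> Z \<oplus> (x \<oplus> y) \<otimes> T = v \<otimes> Z \<oplus> (x \<oplus> y) \<otimes> T" .
      then have "u \<otimes> Z = v \<otimes> Z" by (subst (asm) add.right_cancel) (auto intro: m_closed)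
      moreover have "Z = z \<otimes> list_prod R bs" by (simp add: Z_def bs list_prod_mult_hd)
      ultimately show ?thesis by simp
    qed
    then show "u \<otimes> z \<otimes> list_prod R bs = v \<otimes> z \<otimes> list_prod R bs"
      by (simp add: m_assoc)
  qed
  have "u = v"
  proof (rule cancel_both[where r = r and s = r])
    fix p q as bs
    assume h: "p \<in> I" "q \<in> I" "length as = Suc r" "set as \<subseteq> P p p" "length bs = Suc r" "set bs \<subseteq> P q q"
    let ?A = "list_prod R as" and ?B = "list_prod R bs"
    have A: "?A \<in> P p p" and B: "?B \<in> P q q" using h by (auto intro!: list_prod_P)
    then have AB [simp]: "?A \<in> carrier R" "?B \<in> carrier R" using h by (auto intro: P_carrier)
    show "?A \<otimes> (u \<otimes> ?B) = ?A \<otimes> (v \<otimes> ?B)"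
    proof (cases "p = i \<and> q = i")
      case False
      then have "?A \<otimes> (z \<otimes> ?B) = \<zero>" if "z \<in> P i i" for z
        using that i h A B by (intro sandwich_off_corner[of i i p q]) auto
      \<comment> \<open>Away from \<open>(i, i)\<close> the sandwiched \<open>x\<close>,
        \<open>y\<close> are zero, so \<open>d_zero\<close> supplies the premise of
        \<open>d_add_sandwich\<close>.\<close>
      then show ?thesis unfolding u_def v_def using x y h
        by (intro d_add_sandwich) (auto simp: d_zero dest: diagonal_subset)
    next
      case True
      have "?A \<otimes> ((u \<ominus> v) \<otimes> ?B) = \<zero>"
      proof (rule P_faithful[OF i])
        show "?A \<otimes> ((u \<ominus> v) \<otimes> ?B) \<in> P i i" using True A B i by (intro P_corner) auto
        fix w assume w: "w \<in> P i k"
        then have wc [simp]: "w \<in> carrier R" using i by (auto intro: P_carrier)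
        \<comment> \<open>The product of \<open>bs\<close> times \<open>w\<close> is again in
          \<open>P i k\<close>, where \<open>u\<close> and \<open>v\<close> agree.\<close>
        have "u \<otimes> (?B \<otimes> w) = v \<otimes> (?B \<otimes> w)" using True B w i by (intro z P_mult) auto
        then have "(u \<ominus> v) \<otimes> (?B \<otimes> w) = \<zero>"
          by (simp add: minus_eq l_distr l_minus m_closed r_neg)
        then show "?A \<otimes> ((u \<ominus> v) \<otimes> ?B) \<otimes> w = \<zero>"
          by (simp add: m_assoc m_closed r_null)
      qed
      then have "?A \<otimes> (u \<otimes> ?B) \<ominus> ?A \<otimes> (v \<otimes> ?B) = \<zero>"
        by (simp add: minus_eq l_distr l_minus r_distr r_minus m_closed)
      then show ?thesis by (rule eq_if_minus_zero) (simp_all add: m_closed)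
    qed
  qed auto
  then show ?thesis by (simp add: u_def v_def)
qed

text \<open>The corners of arbitrary elements lie in a single \<open>P p q\<close>, so the two
  preceding cases cover them. For \<open>p = q\<close> the second index required by the diagonal
  case comes from the first assumption.\<close>

theorem d_additive:
  assumes "\<And>i. i \<in> I \<Longrightarrow> \<exists>k \<in> I. k \<noteq> i" and x: "x \<in> carrier R" "y \<in> carrier R"
  shows "d (x \<oplus> y) = d x \<oplus> d y"
proof (rule d_addI[OF x])
  fix p q as bs
  assume h: "p \<in> I" "q \<in> I" "length as = Suc r" "set as \<subseteq> P p p" "length bs = Suc r" "set bs \<subseteq> P q q"
  let ?A = "list_prod R as" and ?B = "list_prod R bs"
  have "?A \<in> P p p" "?B \<in> P q q" using h by (auto intro!: list_prod_P)
  then have "?A \<otimes> (x \<otimes> ?B) \<in> P p q" "?A \<otimes> (y \<otimes> ?B) \<in> P p q"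
    using h x by (auto intro: P_corner)
  then show "d (?A \<otimes> (x \<otimes> ?B) \<oplus> ?A \<otimes> (y \<otimes> ?B)) = d (?A \<otimes> (x \<otimes> ?B)) \<oplus> d (?A \<otimes> (y \<otimes> ?B))"
    using d_add_off_diagonal[of p q] d_add_diagonal[of p] assms(1)[of p] h(1,2)
    by (cases "p = q") auto
qed

end


section \<open>Generalized matrix rings\<close>

lemma tensor_relators_subset:
  assumes "bimodule R S M" "bimodule S T N"
  shows "tensor_relators S M N \<subseteq> carrier (tensor_free M N)"
proof -
  interpret M: bimodule R S M by fact
  interpret N: bimodule S T N by fact
  have d: "u - v \<in> carrier (tensor_free M N)"
    if "u \<in> carrier (tensor_free M N)" "v \<in> carrier (tensor_free M N)" for u v
    using that keys_diff[of u v] by auto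
  show ?thesis
    unfolding tensor_relators_def
    by (auto intro!: d simp: M.rsmult_closed N.lsmult_closed simp del: carrier_free_Abelian_group_iff)
qed

lemma normal_tensor_kernel:
  assumes "bimodule R S M" "bimodule S T N"
  shows "tensor_kernel S M N \<lhd> tensor_free M N"
proof -
  interpret F: comm_group "tensor_free M N" by (rule abelian_free_Abelian_group)
  show ?thesis unfolding tensor_kernel_def
    using tensor_relators_subset[OF assms]
    by (intro F.normal_iff_subgroup[THEN iffD2] F.generate_is_subgroup)
qed

lemma tensor_closed:
  assumes "bimodule R S M" "bimodule S T N" "x \<in> carrier M" "y \<in> carrier N"
  shows "tensor S M N x y \<in> carrier (tensor_product S M N)"
  using assms(3,4)
  by (auto simp: tensor_def tensor_product_def FactGroup_def RCOSETS_def Let_def)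

text \<open>Serves additivity in either argument: the relator lies in the kernel, so both sides are
  the same coset.\<close>

lemma tensor_eq_addI:
  assumes "bimodule R S M" "bimodule S T N"
    and "x \<in> carrier M" "y \<in> carrier N" "x1 \<in> carrier M" "y1 \<in> carrier N" "x2 \<in> carrier M" "y2 \<in> carrier N"
    and rel: "frag_of (x, y) - frag_of (x1, y1) - frag_of (x2, y2) \<in> tensor_relators S M N"
  shows "tensor S M N x y = tensor S M N x1 y1 \<oplus>\<^bsub>tensor_product S M N\<^esub> tensor S M N x2 y2"
proof -
  interpret F: group "tensor_free M N" by (rule group_free_Abelian_group)
  interpret K: normal "tensor_kernel S M N" "tensor_free M N"
    by (rule normal_tensor_kernel[OF assms(1,2)])
  let ?K = "tensor_kernel S M N" and ?F = "tensor_free M N"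
  let ?u = "frag_of (x, y)" and ?v = "frag_of (x1, y1) + frag_of (x2, y2)"
  have f: "frag_of (x, y) \<in> carrier ?F" "frag_of (x1, y1) \<in> carrier ?F" "frag_of (x2, y2) \<in> carrier ?F"
    using assms(3-8) by (simp_all del: carrier_free_Abelian_group_iff)
  then have v: "?v \<in> carrier ?F"
    using F.m_closed[of "frag_of (x1, y1)" "frag_of (x2, y2)"] by simp
  have "?u - ?v \<in> ?K" unfolding tensor_kernel_def
    using generate.incl[OF rel] by (simp add: diff_diff_eq)
  then have "?u \<in> ?K #>\<^bsub>?F\<^esub> ?v" unfolding r_coset_def by force
  then have "?K #>\<^bsub>?F\<^esub> ?u = ?K #>\<^bsub>?F\<^esub> ?v"
    using v K.subgroup_axioms F.repr_independence by metis
  also have "\<dots> = (?K #>\<^bsub>?F\<^esub> frag_of (x1, y1)) <#>\<^bsub>?F\<^esub> (?K #>\<^bsub>?F\<^esub> frag_of (x2, y2))"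
    using K.rcos_sum[OF f(2,3)] by simp
  finally show ?thesis by (simp add: tensor_def tensor_product_def FactGroup_def Let_def)
qed

context generalized_matrix_ring
begin

abbreviation N :: "nat set" where
  "N \<equiv> {1..n}"

section \<open>The products \<open>circ\<close> of entries\<close>

lemma abelian_group_M: "\<lbrakk>i \<in> N; j \<in> N\<rbrakk> \<Longrightarrow> abelian_group (M i j)"
  by (rule bimodule.axioms(3)[OF bimodule])

lemma carrier_diagonal: "i \<in> N \<Longrightarrow> carrier (M i i) = carrier (R i)"
  by (simp add: diagonal regular_bimodule_def)

lemma zero_diagonal: "i \<in> N \<Longrightarrow> \<zero>\<^bsub>M i i\<^esub> = \<zero>\<^bsub>R i\<^esub>"
  by (simp add: diagonal regular_bimodule_def)

lemma circ_closed:
  assumes "i \<in> N" "j \<in> N" "k \<in> N" "a \<in> carrier (M i j)" "b \<in> carrier (M j k)"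
  shows "circ i j k a b \<in> carrier (M i k)"
  using phi_hom[OF assms(1-3)] assms tensor_closed[OF bimodule bimodule]
  by (auto simp: circ_def bimodule_hom_def)

lemma circ_add_left:
  assumes "i \<in> N" "j \<in> N" "k \<in> N" "a \<in> carrier (M i j)" "a' \<in> carrier (M i j)" "b \<in> carrier (M j k)"
  shows "circ i j k (a \<oplus>\<^bsub>M i j\<^esub> a') b = circ i j k a b \<oplus>\<^bsub>M i k\<^esub> circ i j k a' b"
proof -
  interpret abelian_group "M i j" using assms by (intro abelian_group_M)
  note bi = bimodule[OF assms(1,2)] bimodule[OF assms(2,3)]
  have "tensor (R j) (M i j) (M j k) (a \<oplus>\<^bsub>M i j\<^esub> a') b =
      tensor (R j) (M i j) (M j k) a b
      \<oplus>\<^bsub>tensor_product (R j) (M i j) (M j k)\<^esub> tensor (R j) (M i j) (M j k) a' b"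
    using assms by (intro tensor_eq_addI[OF bi]) (auto simp: tensor_relators_def)
  then show ?thesis
    using phi_hom[OF assms(1-3)] tensor_closed[OF bi] assms
    by (simp add: circ_def bimodule_hom_def)
qed

lemma circ_add_right:
  assumes "i \<in> N" "j \<in> N" "k \<in> N" "a \<in> carrier (M i j)" "b \<in> carrier (M j k)" "b' \<in> carrier (M j k)"
  shows "circ i j k a (b \<oplus>\<^bsub>M j k\<^esub> b') = circ i j k a b \<oplus>\<^bsub>M i k\<^esub> circ i j k a b'"
proof -
  interpret abelian_group "M j k" using assms by (intro abelian_group_M)
  note bi = bimodule[OF assms(1,2)] bimodule[OF assms(2,3)]
  have "tensor (R j) (M i j) (M j k) a (b \<oplus>\<^bsub>M j k\<^esub> b') =
      tensor (R j) (M i j) (M j k) a b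
      \<oplus>\<^bsub>tensor_product (R j) (M i j) (M j k)\<^esub> tensor (R j) (M i j) (M j k) a b'"
    using assms by (intro tensor_eq_addI[OF bi]) (auto simp: tensor_relators_def)
  then show ?thesis
    using phi_hom[OF assms(1-3)] tensor_closed[OF bi] assms
    by (simp add: circ_def bimodule_hom_def)
qed

lemma circ_assoc:
  assumes "i \<in> N" "k \<in> N" "l \<in> N" "j \<in> N"
    "a \<in> carrier (M i k)" "b \<in> carrier (M k l)" "c \<in> carrier (M l j)"
  shows "circ i l j (circ i k l a b) c = circ i k j a (circ k l j b c)"
  using phi_assoc[OF assms] by (simp add: circ_def)

text \<open>Links \<open>circ\<close> with the module actions, in terms of which the faithfulness
  assumptions are stated.\<close>

lemma circ_lsmult:
  "\<lbrakk>i \<in> N; j \<in> N; r \<in> carrier (R i); x \<in> carrier (M i j)\<rbrakk> \<Longrightarrow> circ i i j r x = lsmult (M i j) r x"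
  by (simp add: circ_def phi_left)

lemma circ_rsmult:
  "\<lbrakk>i \<in> N; j \<in> N; x \<in> carrier (M i j); s \<in> carrier (R j)\<rbrakk> \<Longrightarrow> circ i j j x s = rsmult (M i j) x s"
  by (simp add: circ_def phi_right)

lemma circ_zero_left:
  assumes "i \<in> N" "j \<in> N" "k \<in> N" "b \<in> carrier (M j k)"
  shows "circ i j k \<zero>\<^bsub>M i j\<^esub> b = \<zero>\<^bsub>M i k\<^esub>"
  using assms
  by (intro additive_zero[where f = "\<lambda>a. circ i j k a b"] abelian_group_M)
    (auto intro: circ_closed circ_add_left)

lemma circ_zero_right:
  assumes "i \<in> N" "j \<in> N" "k \<in> N" "a \<in> carrier (M i j)"
  shows "circ i j k a \<zero>\<^bsub>M j k\<^esub> = \<zero>\<^bsub>M i k\<^esub>"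
  using assms
  by (intro additive_zero[where f = "circ i j k a"] abelian_group_M)
    (auto intro: circ_closed circ_add_right)

section \<open>The ring of matrices\<close>

lemma matrices_closed:
  "\<lbrakk>A \<in> carrier matrices; i \<in> N; j \<in> N\<rbrakk> \<Longrightarrow> A (i, j) \<in> carrier (M i j)"
  by (force simp: matrices_def)

lemma matrices_memI:
  "(\<And>i j. \<lbrakk>i \<in> N; j \<in> N\<rbrakk> \<Longrightarrow> f i j \<in> carrier (M i j))
    \<Longrightarrow> (\<lambda>(i, j) \<in> N \<times> N. f i j) \<in> carrier matrices"
  by (auto simp: matrices_def)

lemma matrices_eqI:
  assumes "A \<in> carrier matrices" "B \<in> carrier matrices"
    and "\<And>i j. \<lbrakk>i \<in> N; j \<in> N\<rbrakk> \<Longrightarrow> A (i, j) = B (i, j)"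
  shows "A = B"
  by (rule PiE_ext[where k = "N \<times> N"]) (use assms in \<open>auto simp: matrices_def\<close>)

lemma matrices_add:
  "\<lbrakk>i \<in> N; j \<in> N\<rbrakk> \<Longrightarrow> (A \<oplus>\<^bsub>matrices\<^esub> B) (i, j) = A (i, j) \<oplus>\<^bsub>M i j\<^esub> B (i, j)"
  by (simp add: matrices_def)

lemma matrices_mult:
  "\<lbrakk>i \<in> N; k \<in> N\<rbrakk> \<Longrightarrow>
    (A \<otimes>\<^bsub>matrices\<^esub> B) (i, k) = (\<Oplus>\<^bsub>M i k\<^esub>j \<in> N. circ i j k (A (i, j)) (B (j, k)))"
  by (simp add: matrices_def)

lemma matrices_zero: "\<lbrakk>i \<in> N; j \<in> N\<rbrakk> \<Longrightarrow> \<zero>\<^bsub>matrices\<^esub> (i, j) = \<zero>\<^bsub>M i j\<^esub>"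
  by (simp add: matrices_def)

lemma matrices_add_closed:
  assumes "A \<in> carrier matrices" "B \<in> carrier matrices"
  shows "A \<oplus>\<^bsub>matrices\<^esub> B \<in> carrier matrices"
proof -
  have "A (i, j) \<oplus>\<^bsub>M i j\<^esub> B (i, j) \<in> carrier (M i j)" if "i \<in> N" "j \<in> N" for i j
    using that assms abelian_groupE(1)[OF abelian_group_M] matrices_closed by blast
  then show ?thesis using matrices_memI by (simp add: matrices_def)
qed

lemma matrices_zero_closed: "\<zero>\<^bsub>matrices\<^esub> \<in> carrier matrices"
  using matrices_memI[of "\<lambda>i j. \<zero>\<^bsub>M i j\<^esub>"] abelian_groupE(2)[OF abelian_group_M]
  by (simp add: matrices_def)

lemma matrices_mult_closed:
  assumes "A \<in> carrier matrices" "B \<in> carrier matrices"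
  shows "A \<otimes>\<^bsub>matrices\<^esub> B \<in> carrier matrices"
proof -
  have "(\<Oplus>\<^bsub>M i k\<^esub>j \<in> N. circ i j k (A (i, j)) (B (j, k))) \<in> carrier (M i k)"
    if "i \<in> N" "k \<in> N" for i k
  proof -
    interpret abelian_group "M i k" using that by (rule abelian_group_M)
    show ?thesis using that assms by (intro finsum_closed) (auto simp: circ_closed matrices_closed)
  qed
  then show ?thesis using matrices_memI by (simp add: matrices_def)
qed

lemma abelian_group_matrices: "abelian_group matrices"
proof (rule abelian_groupI)
  fix A B C assume "A \<in> carrier matrices" "B \<in> carrier matrices" "C \<in> carrier matrices"
  then show "A \<oplus>\<^bsub>matrices\<^esub> B \<oplus>\<^bsub>matrices\<^esub> C = A \<oplus>\<^bsub>matrices\<^esub> (B \<oplus>\<^bsub>matrices\<^esub> C)"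
    by (intro matrices_eqI)
      (auto simp: matrices_add matrices_closed abelian_groupE(3)[OF abelian_group_M] intro!: matrices_add_closed)
next
  fix A B assume "A \<in> carrier matrices" "B \<in> carrier matrices"
  then show "A \<oplus>\<^bsub>matrices\<^esub> B = B \<oplus>\<^bsub>matrices\<^esub> A"
    by (intro matrices_eqI)
      (auto simp: matrices_add matrices_closed abelian_groupE(4)[OF abelian_group_M] intro!: matrices_add_closed)
next
  fix A assume A: "A \<in> carrier matrices"
  then show "\<zero>\<^bsub>matrices\<^esub> \<oplus>\<^bsub>matrices\<^esub> A = A"
    by (intro matrices_eqI)
      (auto simp: matrices_add matrices_zero matrices_closed abelian_groupE(5)[OF abelian_group_M]
        intro!: matrices_add_closed matrices_zero_closed)
  define B where "B = (\<lambda>(i, j) \<in> N \<times> N. \<ominus>\<^bsub>M i j\<^esub> A (i, j))"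
  have "B \<in> carrier matrices" unfolding B_def
    using A by (intro matrices_memI) (simp add: abelian_group.a_inv_closed abelian_group_M matrices_closed)
  moreover have "B \<oplus>\<^bsub>matrices\<^esub> A = \<zero>\<^bsub>matrices\<^esub>"
    using A calculation
    by (intro matrices_eqI)
      (auto simp: matrices_add matrices_zero matrices_closed B_def abelian_group.l_neg abelian_group_M
        intro!: matrices_add_closed matrices_zero_closed)
  ultimately show "\<exists>B \<in> carrier matrices. B \<oplus>\<^bsub>matrices\<^esub> A = \<zero>\<^bsub>matrices\<^esub>" by blast
qed (auto intro: matrices_add_closed matrices_zero_closed)

lemma matrices_l_distr:
  assumes "A \<in> carrier matrices" "B \<in> carrier matrices" "C \<in> carrier matrices"
  shows "(A \<oplus>\<^bsub>matrices\<^esub> B) \<otimes>\<^bsub>matrices\<^esub> C = A \<otimes>\<^bsub>matrices\<^esub> C \<oplus>\<^bsub>matrices\<^esub> B \<otimes>\<^bsub>matrices\<^esub> C"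
proof (rule matrices_eqI)
  fix i k assume ik: "i \<in> N" "k \<in> N"
  interpret abelian_group "M i k" using ik by (rule abelian_group_M)
  have c: "circ i j k (D (i, j)) (C (j, k)) \<in> carrier (M i k)" if "D \<in> carrier matrices" "j \<in> N" for D j
    using that ik assms(3) by (auto simp: circ_closed matrices_closed)
  have "((A \<oplus>\<^bsub>matrices\<^esub> B) \<otimes>\<^bsub>matrices\<^esub> C) (i, k) =
      (\<Oplus>\<^bsub>M i k\<^esub>j \<in> N. circ i j k (A (i, j)) (C (j, k)) \<oplus>\<^bsub>M i k\<^esub> circ i j k (B (i, j)) (C (j, k)))"
    unfolding matrices_mult[OF ik] using ik assms c
    by (intro finsum_cong')
      (auto simp: matrices_add circ_add_left matrices_closed)
  also have "\<dots> = (A \<otimes>\<^bsub>matrices\<^esub> C \<oplus>\<^bsub>matrices\<^esub> B \<otimes>\<^bsub>matrices\<^esub> C) (i, k)"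
    unfolding matrices_mult[OF ik] matrices_add[OF ik] using assms c by (intro finsum_addf) auto
  finally show "((A \<oplus>\<^bsub>matrices\<^esub> B) \<otimes>\<^bsub>matrices\<^esub> C) (i, k) =
      (A \<otimes>\<^bsub>matrices\<^esub> C \<oplus>\<^bsub>matrices\<^esub> B \<otimes>\<^bsub>matrices\<^esub> C) (i, k)" .
qed (use assms in \<open>auto intro!: matrices_add_closed matrices_mult_closed\<close>)

lemma matrices_r_distr:
  assumes "A \<in> carrier matrices" "B \<in> carrier matrices" "C \<in> carrier matrices"
  shows "C \<otimes>\<^bsub>matrices\<^esub> (A \<oplus>\<^bsub>matrices\<^esub> B) = C \<otimes>\<^bsub>matrices\<^esub> A \<oplus>\<^bsub>matrices\<^esub> C \<otimes>\<^bsub>matrices\<^esub> B"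
proof (rule matrices_eqI)
  fix i k assume ik: "i \<in> N" "k \<in> N"
  interpret abelian_group "M i k" using ik by (rule abelian_group_M)
  have c: "circ i j k (C (i, j)) (D (j, k)) \<in> carrier (M i k)" if "D \<in> carrier matrices" "j \<in> N" for D j
    using that ik assms(3) by (auto simp: circ_closed matrices_closed)
  have "(C \<otimes>\<^bsub>matrices\<^esub> (A \<oplus>\<^bsub>matrices\<^esub> B)) (i, k) =
      (\<Oplus>\<^bsub>M i k\<^esub>j \<in> N. circ i j k (C (i, j)) (A (j, k)) \<oplus>\<^bsub>M i k\<^esub> circ i j k (C (i, j)) (B (j, k)))"
    unfolding matrices_mult[OF ik] using ik assms c
    by (intro finsum_cong')
      (auto simp: matrices_add circ_add_right matrices_closed)
  also have "\<dots> = (C \<otimes>\<^bsub>matrices\<^esub> A \<oplus>\<^bsub>matrices\<^esub> C \<otimes>\<^bsub>matrices\<^esub> B) (i, k)"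
    unfolding matrices_mult[OF ik] matrices_add[OF ik] using assms c by (intro finsum_addf) auto
  finally show "(C \<otimes>\<^bsub>matrices\<^esub> (A \<oplus>\<^bsub>matrices\<^esub> B)) (i, k) =
      (C \<otimes>\<^bsub>matrices\<^esub> A \<oplus>\<^bsub>matrices\<^esub> C \<otimes>\<^bsub>matrices\<^esub> B) (i, k)" .
qed (use assms in \<open>auto intro!: matrices_add_closed matrices_mult_closed\<close>)

lemma matrices_m_assoc:
  assumes "A \<in> carrier matrices" "B \<in> carrier matrices" "C \<in> carrier matrices"
  shows "A \<otimes>\<^bsub>matrices\<^esub> B \<otimes>\<^bsub>matrices\<^esub> C = A \<otimes>\<^bsub>matrices\<^esub> (B \<otimes>\<^bsub>matrices\<^esub> C)"
proof (rule matrices_eqI)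
  fix i l assume il: "i \<in> N" "l \<in> N"
  interpret abelian_group "M i l" using il by (rule abelian_group_M)
  \<comment> \<open>The summand common to both bracketings: associativity of \<open>circ\<close>
    brings the left one to this form, and the two double sums differ only in the order of
    summation.\<close>
  define f where "f j k = circ i j l (A (i, j)) (circ j k l (B (j, k)) (C (k, l)))" for j k
  have f: "f j k \<in> carrier (M i l)" if "j \<in> N" "k \<in> N" for j k
    unfolding f_def using that il assms by (intro circ_closed matrices_closed)
  have L: "circ i k l ((A \<otimes>\<^bsub>matrices\<^esub> B) (i, k)) (C (k, l)) = (\<Oplus>\<^bsub>M i l\<^esub>j \<in> N. f j k)"
    if k: "k \<in> N" for k
  proof -
    have "circ i k l ((A \<otimes>\<^bsub>matrices\<^esub> B) (i, k)) (C (k, l)) =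
        (\<Oplus>\<^bsub>M i l\<^esub>j \<in> N. circ i k l (circ i j k (A (i, j)) (B (j, k))) (C (k, l)))"
      unfolding matrices_mult[OF il(1) k] using k il assms
      by (intro additive_finsum[where f = "\<lambda>a. circ i k l a (C (k, l))"] abelian_group_M)
        (auto simp: circ_closed circ_add_left matrices_closed)
    also have "\<dots> = (\<Oplus>\<^bsub>M i l\<^esub>j \<in> N. f j k)"
      using k il assms f by (intro finsum_cong') (auto simp: f_def circ_assoc matrices_closed)
    finally show ?thesis .
  qed
  have R: "circ i j l (A (i, j)) ((B \<otimes>\<^bsub>matrices\<^esub> C) (j, l)) = (\<Oplus>\<^bsub>M i l\<^esub>k \<in> N. f j k)"
    if j: "j \<in> N" for j
    unfolding matrices_mult[OF j il(2)] f_def using j il assms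
    by (intro additive_finsum abelian_group_M)
      (auto simp: circ_closed circ_add_right matrices_closed)
  have "(A \<otimes>\<^bsub>matrices\<^esub> B \<otimes>\<^bsub>matrices\<^esub> C) (i, l) = (\<Oplus>\<^bsub>M i l\<^esub>k \<in> N. \<Oplus>\<^bsub>M i l\<^esub>j \<in> N. f j k)"
    unfolding matrices_mult[OF il, of "A \<otimes>\<^bsub>matrices\<^esub> B"] using L f
    by (intro finsum_cong') (auto intro!: finsum_closed)
  also have "\<dots> = (\<Oplus>\<^bsub>M i l\<^esub>j \<in> N. \<Oplus>\<^bsub>M i l\<^esub>k \<in> N. f j k)"
    using f by (intro finsum_swap) auto
  also have "\<dots> = (A \<otimes>\<^bsub>matrices\<^esub> (B \<otimes>\<^bsub>matrices\<^esub> C)) (i, l)"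
    unfolding matrices_mult[OF il, of A] using R f
    by (intro finsum_cong'[symmetric]) (auto intro!: finsum_closed)
  finally show "(A \<otimes>\<^bsub>matrices\<^esub> B \<otimes>\<^bsub>matrices\<^esub> C) (i, l) =
      (A \<otimes>\<^bsub>matrices\<^esub> (B \<otimes>\<^bsub>matrices\<^esub> C)) (i, l)" .
qed (use assms in \<open>auto intro!: matrices_mult_closed\<close>)

lemma nonunital_ring_matrices: "nonunital_ring matrices"
  by (intro nonunital_ring.intro nonunital_ring_axioms.intro abelian_group_matrices
      matrices_mult_closed matrices_m_assoc matrices_l_distr matrices_r_distr)

section \<open>Matrices with at most one nonzero entry\<close>

definition single :: "nat \<Rightarrow> nat \<Rightarrow> 'a \<Rightarrow> nat \<times> nat \<Rightarrow> 'a" where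
  "single i j x = (\<lambda>(k, l) \<in> N \<times> N. if k = i \<and> l = j then x else \<zero>\<^bsub>M k l\<^esub>)"

lemma single_apply:
  "\<lbrakk>k \<in> N; l \<in> N\<rbrakk> \<Longrightarrow> single i j x (k, l) = (if k = i \<and> l = j then x else \<zero>\<^bsub>M k l\<^esub>)"
  by (simp add: single_def)

text \<open>No range condition on \<open>i\<close> and \<open>j\<close> is imposed: outside the
  index range the case distinction never selects \<open>x\<close>, and the matrix is zero.\<close>

lemma single_closed:
  "x \<in> carrier (M i j) \<Longrightarrow> single i j x \<in> carrier matrices"
  unfolding single_def
  by (intro matrices_memI) (auto simp: abelian_groupE(2)[OF abelian_group_M])

lemma single_zero: "single i j \<zero>\<^bsub>M i j\<^esub> = \<zero>\<^bsub>matrices\<^esub>"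
  by (auto simp: single_def matrices_def intro!: restrict_ext)

lemma single_mult_apply:
  assumes "i \<in> N" "j \<in> N" "x \<in> carrier (M i j)" "B \<in> carrier matrices" "k \<in> N" "l \<in> N"
  shows "(single i j x \<otimes>\<^bsub>matrices\<^esub> B) (k, l) = (if k = i then circ i j l x (B (j, l)) else \<zero>\<^bsub>M k l\<^esub>)"
proof -
  interpret abelian_group "M k l" using assms by (intro abelian_group_M)
  \<comment> \<open>Only the summand at \<open>j' = j\<close> survives; it is written with an
    explicit equality test to match \<open>finsum_singleton\<close>.\<close>
  have "(single i j x \<otimes>\<^bsub>matrices\<^esub> B) (k, l)
      = (\<Oplus>\<^bsub>M k l\<^esub>j' \<in> N. if j = j' then (if k = i then circ i j l x (B (j, l)) else \<zero>\<^bsub>M k l\<^esub>) else \<zero>\<^bsub>M k l\<^esub>)"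
    unfolding matrices_mult[OF assms(5,6)] using assms
    by (intro finsum_cong') (auto simp: single_apply circ_zero_left matrices_closed circ_closed
        abelian_groupE(2)[OF abelian_group_M])
  also have "\<dots> = (if k = i then circ i j l x (B (j, l)) else \<zero>\<^bsub>M k l\<^esub>)"
    using assms by (intro finsum_singleton[where f = "\<lambda>_. _"]) (auto simp: circ_closed matrices_closed)
  finally show ?thesis .
qed

lemma mult_single_apply:
  assumes "i \<in> N" "j \<in> N" "x \<in> carrier (M i j)" "B \<in> carrier matrices" "k \<in> N" "l \<in> N"
  shows "(B \<otimes>\<^bsub>matrices\<^esub> single i j x) (k, l) = (if l = j then circ k i j (B (k, i)) x else \<zero>\<^bsub>M k l\<^esub>)"
proof -
  interpret abelian_group "M k l" using assms by (intro abelian_group_M)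
  have "(B \<otimes>\<^bsub>matrices\<^esub> single i j x) (k, l)
      = (\<Oplus>\<^bsub>M k l\<^esub>i' \<in> N. if i = i' then (if l = j then circ k i j (B (k, i)) x else \<zero>\<^bsub>M k l\<^esub>) else \<zero>\<^bsub>M k l\<^esub>)"
    unfolding matrices_mult[OF assms(5,6)] using assms
    by (intro finsum_cong') (auto simp: single_apply circ_zero_right matrices_closed circ_closed
        abelian_groupE(2)[OF abelian_group_M])
  also have "\<dots> = (if l = j then circ k i j (B (k, i)) x else \<zero>\<^bsub>M k l\<^esub>)"
    using assms by (intro finsum_singleton[where f = "\<lambda>_. _"]) (auto simp: circ_closed matrices_closed)
  finally show ?thesis .
qed

lemma single_mult_single:
  assumes "i \<in> N" "j \<in> N" "k \<in> N" "x \<in> carrier (M i j)" "y \<in> carrier (M j k)"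
  shows "single i j x \<otimes>\<^bsub>matrices\<^esub> single j k y = single i k (circ i j k x y)"
  using assms
  by (intro matrices_eqI)
    (auto simp: single_mult_apply single_closed single_apply circ_zero_right
      intro!: matrices_mult_closed single_closed circ_closed)

lemma single_mult_single_orthogonal:
  assumes "i \<in> N" "j \<in> N" "k \<in> N" "l \<in> N" "j \<noteq> k" "x \<in> carrier (M i j)" "y \<in> carrier (M k l)"
  shows "single i j x \<otimes>\<^bsub>matrices\<^esub> single k l y = \<zero>\<^bsub>matrices\<^esub>"
  using assms
  by (intro matrices_eqI)
    (auto simp: single_mult_apply single_closed single_apply circ_zero_right matrices_zero
      intro!: matrices_mult_closed single_closed matrices_zero_closed)

text \<open>Sandwiching isolates the entry at \<open>(k, l)\<close>. This yields both
  \<open>P_corner\<close> and, entry by entry, \<open>P_nondegenerate\<close>.\<close>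

lemma single_sandwich:
  assumes "k \<in> N" "l \<in> N" "a \<in> carrier (M k k)" "b \<in> carrier (M l l)" "A \<in> carrier matrices"
  shows "single k k a \<otimes>\<^bsub>matrices\<^esub> (A \<otimes>\<^bsub>matrices\<^esub> single l l b)
    = single k l (circ k k l a (circ k l l (A (k, l)) b))"
  using assms
  by (intro matrices_eqI)
    (auto simp: single_mult_apply mult_single_apply single_closed single_apply circ_zero_right
      matrices_closed matrices_mult_closed
      intro!: matrices_mult_closed single_closed circ_closed)

lemma single_eq_zero:
  "\<lbrakk>single i j x = \<zero>\<^bsub>matrices\<^esub>; i \<in> N; j \<in> N\<rbrakk> \<Longrightarrow> x = \<zero>\<^bsub>M i j\<^esub>"
  using single_apply[of i j i j x] matrices_zero[of i j] by simp

text \<open>\<open>P_faithful\<close> comes from the faithful left modules.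
  \<open>P_nondegenerate\<close> is checked at each entry: off the diagonal by
  \<open>two_sided_faithful\<close>, on the diagonal by the two annihilator conditions.\<close>

lemma peirce_ring_matrices:
  assumes R: "\<And>i a. \<lbrakk>i \<in> N; a \<in> carrier (R i); \<forall>r \<in> carrier (R i). a \<otimes>\<^bsub>R i\<^esub> r = \<zero>\<^bsub>R i\<^esub>\<rbrakk> \<Longrightarrow> a = \<zero>\<^bsub>R i\<^esub>"
    and L: "\<And>i a. \<lbrakk>i \<in> N; a \<in> carrier (R i); \<forall>r \<in> carrier (R i). r \<otimes>\<^bsub>R i\<^esub> a = \<zero>\<^bsub>R i\<^esub>\<rbrakk> \<Longrightarrow> a = \<zero>\<^bsub>R i\<^esub>"
  shows "peirce_ring matrices N (\<lambda>i j. single i j ` carrier (M i j))"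
proof (intro peirce_ring.intro peirce_ring_axioms.intro nonunital_ring_matrices)
  show "single i j ` carrier (M i j) \<subseteq> carrier matrices" for i j
    by (auto intro: single_closed)
next
  fix i j k x y
  assume "i \<in> N" "j \<in> N" "k \<in> N" "x \<in> single i j ` carrier (M i j)" "y \<in> single j k ` carrier (M j k)"
  then show "x \<otimes>\<^bsub>matrices\<^esub> y \<in> single i k ` carrier (M i k)"
    by (auto simp: single_mult_single circ_closed)
next
  fix i j k l x y
  assume "i \<in> N" "j \<in> N" "k \<in> N" "l \<in> N" "j \<noteq> k"
    "x \<in> single i j ` carrier (M i j)" "y \<in> single k l ` carrier (M k l)"
  then show "x \<otimes>\<^bsub>matrices\<^esub> y = \<zero>\<^bsub>matrices\<^esub>"
    by (auto simp: single_mult_single_orthogonal)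
next
  fix k l a b x
  assume "k \<in> N" "l \<in> N" "a \<in> single k k ` carrier (M k k)" "b \<in> single l l ` carrier (M l l)"
    "x \<in> carrier matrices"
  then show "a \<otimes>\<^bsub>matrices\<^esub> (x \<otimes>\<^bsub>matrices\<^esub> b) \<in> single k l ` carrier (M k l)"
    by (auto simp: single_sandwich circ_closed matrices_closed)
next
  fix i k x
  assume ik: "i \<in> N" "k \<in> N" "i \<noteq> k" "x \<in> single i i ` carrier (M i i)"
    and z: "\<And>z. z \<in> single i k ` carrier (M i k) \<Longrightarrow> x \<otimes>\<^bsub>matrices\<^esub> z = \<zero>\<^bsub>matrices\<^esub>"
  then obtain r where r: "r \<in> carrier (R i)" "r \<in> carrier (M i i)" "x = single i i r"
    by (auto simp: carrier_diagonal)
  have "lsmult (M i k) r y = \<zero>\<^bsub>M i k\<^esub>" if y: "y \<in> carrier (M i k)" for y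
    using z[of "single i k y"] single_eq_zero[of i k "circ i i k r y"] ik r y
    by (simp add: single_mult_single circ_lsmult)
  then have "r = \<zero>\<^bsub>R i\<^esub>"
    using faithful_left[OF ik(1-3)] r by (simp add: faithful_left_module_def)
  then show "x = \<zero>\<^bsub>matrices\<^esub>" using r single_zero[of i i] zero_diagonal[OF ik(1)] by simp
next
  fix A
  assume A: "A \<in> carrier matrices"
    and z: "\<And>k l a b. \<lbrakk>k \<in> N; l \<in> N; a \<in> single k k ` carrier (M k k); b \<in> single l l ` carrier (M l l)\<rbrakk>
      \<Longrightarrow> a \<otimes>\<^bsub>matrices\<^esub> (A \<otimes>\<^bsub>matrices\<^esub> b) = \<zero>\<^bsub>matrices\<^esub>"
  show "A = \<zero>\<^bsub>matrices\<^esub>"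
  proof (rule matrices_eqI[OF A matrices_zero_closed])
    fix k l assume kl: "k \<in> N" "l \<in> N"
    interpret bimodule "R k" "R l" "M k l" using kl by (rule bimodule)
    have c: "A (k, l) \<in> carrier (M k l)" using A kl by (rule matrices_closed)
    have 0: "lsmult (M k l) r (rsmult (M k l) (A (k, l)) s) = \<zero>\<^bsub>M k l\<^esub>"
      if rs: "r \<in> carrier (R k)" "s \<in> carrier (R l)" for r s
    proof -
      have "single k k r \<otimes>\<^bsub>matrices\<^esub> (A \<otimes>\<^bsub>matrices\<^esub> single l l s) = \<zero>\<^bsub>matrices\<^esub>"
        using z kl rs by (simp add: carrier_diagonal)
      then have "circ k k l r (circ k l l (A (k, l)) s) = \<zero>\<^bsub>M k l\<^esub>"
        using kl rs A by (simp add: single_sandwich carrier_diagonal single_eq_zero)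
      then show ?thesis using kl rs c by (simp add: circ_lsmult circ_rsmult rsmult_closed)
    qed
    have "A (k, l) = \<zero>\<^bsub>M k l\<^esub>"
    proof (cases "k = l")
      case False
      then show ?thesis using two_sided_faithful[OF kl False c] 0 c by (simp add: smult_assoc)
    next
      case True
      have A': "A (k, k) \<in> carrier (R k)" using c True kl by (simp add: carrier_diagonal)
      \<comment> \<open>On the diagonal both actions are ring multiplication. First \<open>L\<close>
        removes \<open>r\<close>, then \<open>R\<close> removes \<open>s\<close>.\<close>
      have "r \<otimes>\<^bsub>R k\<^esub> (A (k, k) \<otimes>\<^bsub>R k\<^esub> s) = \<zero>\<^bsub>R k\<^esub>"
        if "r \<in> carrier (R k)" "s \<in> carrier (R k)" for r s
        using 0[of r s] that True kl by (simp add: diagonal regular_bimodule_def)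
      then have "A (k, k) \<otimes>\<^bsub>R k\<^esub> s = \<zero>\<^bsub>R k\<^esub>" if "s \<in> carrier (R k)" for s
        using that A' by (intro L[OF kl(1)] R.m_closed) auto
      then show ?thesis using R[OF kl(1) A'] True zero_diagonal[OF kl(1)] by simp
    qed
    then show "A (k, l) = \<zero>\<^bsub>matrices\<^esub> (k, l)" using kl by (simp add: matrices_zero)
  qed
qed

end

theorem theorem3p2:
  fixes n m :: nat
    and R :: "nat \<Rightarrow> 'a ring"
    and M :: "nat \<Rightarrow> nat \<Rightarrow> ('a, 'a, 'a) bimodule"
    and \<phi> :: "nat \<Rightarrow> nat \<Rightarrow> nat \<Rightarrow> ('a \<times> 'a \<Rightarrow>\<^sub>0 int) set \<Rightarrow> 'a"
    and d :: "(nat \<times> nat \<Rightarrow> 'a) \<Rightarrow> nat \<times> nat \<Rightarrow> 'a"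
  defines "G \<equiv> generalized_matrix_ring.matrices n R M \<phi>"
  assumes n: "n \<ge> 2" and m: "m \<ge> 2"
    and gmr: "generalized_matrix_ring n R M \<phi>"
    and i: "\<And>i j a. \<lbrakk>i \<in> {1..n}; j \<in> {1..n}; i \<noteq> j; a \<in> carrier (R i);
        \<forall>r \<in> carrier (R i). a \<otimes>\<^bsub>R i\<^esub> r = \<zero>\<^bsub>R i\<^esub>\<rbrakk> \<Longrightarrow> a = \<zero>\<^bsub>R i\<^esub>"
    and ii: "\<And>i j b. \<lbrakk>i \<in> {1..n}; j \<in> {1..n}; i \<noteq> j; b \<in> carrier (R j);
        \<forall>r \<in> carrier (R j). r \<otimes>\<^bsub>R j\<^esub> b = \<zero>\<^bsub>R j\<^esub>\<rbrakk> \<Longrightarrow> b = \<zero>\<^bsub>R j\<^esub>"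
    and d: "multiplicative_derivation m G d"
  shows "\<forall>x \<in> carrier G. \<forall>y \<in> carrier G. d (x \<oplus>\<^bsub>G\<^esub> y) = d x \<oplus>\<^bsub>G\<^esub> d y"
proof -
  interpret generalized_matrix_ring n R M \<phi> by (rule gmr)
  obtain r where r: "m = Suc (Suc r)" using m by (metis add_2_eq_Suc le_iff_add)
  \<comment> \<open>Since \<open>n\<close> is at least 2, each index has a distinct partner. It
    instantiates \<open>j\<close> in the two annihilator conditions and provides the second index
    for \<open>d_additive\<close>.\<close>
  have other: "\<exists>k \<in> {1..n}. k \<noteq> i" for i
    using n by (intro bexI[of _ "if i = 1 then 2 else 1"]) auto
  have "peirce_ring G {1..n} (\<lambda>i j. single i j ` carrier (M i j))"
    unfolding G_def using other i ii by (intro peirce_ring_matrices) metis+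
  then interpret peirce_derivation G "{1..n}" "\<lambda>i j. single i j ` carrier (M i j)" d r
    using d by (simp add: peirce_derivation.intro peirce_derivation_axioms.intro r)
  show ?thesis using d_additive other by blast
qed

end
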